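(* A generic holomorphic quadratic self-map of $\mathbb{P}^2$ having an invariant line is completely determined, up to linear equivalence, by the multipliers at all of its fixed points. Precisely: there is a nonempty Zariski open subset $U\subset E^{(4)}$ such that if $f,g\in U$ have the same values of $(t_1,d_1,\dots,t_4,d_4)$ and the same unordered collection of pairs $\{(u_5,v_5),(u_6,v_6),(u_7,v_7)\}$, then $g=\phi\circ f\circ\phi^{-1}$ for some $\phi\in\operatorname{Aut}(\mathbb{P}^2,\ell)$ (respecting the markings).
   Context: Fix a line $\ell\subset\mathbb{P}^2$. $E^{(4)}$ is the variety of holomorphic quadratic self-maps $f$ of $\mathbb{P}^2$ with $f(\ell)\subset\ell$, all of whose fixed points are isolated and non-degenerate ($\det(\mathbf{I}-Df|_p)\neq0$), with the four fixed points off $\ell$ marked and ordered $p_1,\dots,p_4$; $p_5,p_6,p_7$ are the fixed points on $\ell$. $t_i,d_i$ ($i\le4$) are the trace and determinant of $\mathbf{I}-Df|_{p_i}$; for $j=5,6,7$, $u_j,v_j$ are the eigenvalues of $\mathbf{I}-Df|_{p_j}$, $u_j$ being the one tangent to $\ell$. $\operatorname{Aut}(\mathbb{P}^2,\ell)\subset\mathrm{PGL}(3,\mathbb{C})$ is the group of automorphisms preserving $\ell$. *)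

theory Defs
  imports "HOL-Analysis.Analysis" "HOL-Library.Multiset"
begin

text \<open>Homogeneous coordinates on P^2: nonzero vectors in complex^3, indices 1,2,3
  (the three distinct elements of the numeral type 3). The fixed invariant line is
  ell = {x3 = 0}. A quadratic self-map is given by a coefficient tensor Q,
  F_i(x) = sum_{j,k} Q_ijk x_j x_k.\<close>

type_synonym vec3 = "complex^3"
type_synonym qmap = "complex^3^3^3"

definition qeval :: "qmap \<Rightarrow> vec3 \<Rightarrow> vec3" where
  "qeval Q x = (\<chi> i. \<Sum>j\<in>UNIV. \<Sum>k\<in>UNIV. Q$i$j$k * x$j * x$k)"

definition holo_quad :: "qmap \<Rightarrow> bool" where
  "holo_quad Q \<longleftrightarrow> (\<forall>x. qeval Q x = 0 \<longrightarrow> x = 0)"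

definition preserves_ell :: "qmap \<Rightarrow> bool" where
  "preserves_ell Q \<longleftrightarrow> (\<forall>x::vec3. x$3 = 0 \<longrightarrow> qeval Q x $ 3 = 0)"

definition is_fixed :: "qmap \<Rightarrow> vec3 \<Rightarrow> bool" where
  "is_fixed Q x \<longleftrightarrow> x \<noteq> 0 \<and> (\<exists>c. qeval Q x = c *s x)"

definition chart_idx :: "vec3 \<Rightarrow> 3" where
  "chart_idx x = (if x$1 \<noteq> 0 then 1 else if x$2 \<noteq> 0 then 2 else 3)"

definition normalize3 :: "vec3 \<Rightarrow> vec3" where
  "normalize3 x = (1 / x $ chart_idx x) *s x"

definition chart_coords :: "3 \<Rightarrow> 3 \<times> 3" where
  "chart_coords k = (if k = 1 then (2,3) else if k = 2 then (1,3) else (1,2))"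

definition chart_map :: "qmap \<Rightarrow> 3 \<Rightarrow> vec3 \<Rightarrow> vec3" where
  "chart_map Q k y = (1 / qeval Q y $ k) *s qeval Q y"

definition jac :: "qmap \<Rightarrow> vec3 \<Rightarrow> 3 \<Rightarrow> 3 \<Rightarrow> complex" where
  "jac Q x i j = deriv (\<lambda>s. chart_map Q (chart_idx x) (normalize3 x + s *s axis j 1) $ i) 0"

definition tr_IDf :: "qmap \<Rightarrow> vec3 \<Rightarrow> complex" where
  "tr_IDf Q x = (let (a,b) = chart_coords (chart_idx x) in (1 - jac Q x a a) + (1 - jac Q x b b))"

definition det_IDf :: "qmap \<Rightarrow> vec3 \<Rightarrow> complex" where
  "det_IDf Q x = (let (a,b) = chart_coords (chart_idx x) in
      (1 - jac Q x a a) * (1 - jac Q x b b) - jac Q x a b * jac Q x b a)"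

text \<open>For a fixed point on ell: (u,v) eigenvalues of I - Df, u tangent to ell.
  In the chart {x_k = 1} (k in {1,2}) the direction tangent to ell is e_j, j the
  other index in {1,2}; the transverse direction is e_3.\<close>
definition uv_ell :: "qmap \<Rightarrow> vec3 \<Rightarrow> complex \<times> complex" where
  "uv_ell Q x = (let j = fst (chart_coords (chart_idx x)) in
      (1 - jac Q x j j, 1 - jac Q x 3 3))"

definition FixN :: "qmap \<Rightarrow> vec3 set" where
  "FixN Q = {x. is_fixed Q x \<and> normalize3 x = x}"

definition E4 :: "qmap \<Rightarrow> complex^3^4 \<Rightarrow> bool" where
  "E4 Q P \<longleftrightarrow> holo_quad Q \<and> preserves_ell Q
     \<and> finite (FixN Q)
     \<and> (\<forall>x. is_fixed Q x \<longrightarrow> det_IDf Q x \<noteq> 0)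
     \<and> (\<forall>i. is_fixed Q (P$i) \<and> P$i$3 \<noteq> 0)
     \<and> (\<forall>i j. i \<noteq> j \<longrightarrow> normalize3 (P$i) \<noteq> normalize3 (P$j))
     \<and> (\<forall>x. is_fixed Q x \<and> x$3 \<noteq> 0 \<longrightarrow> (\<exists>i. normalize3 x = normalize3 (P$i)))"

definition ell_multipliers :: "qmap \<Rightarrow> (complex \<times> complex) multiset" where
  "ell_multipliers Q = image_mset (uv_ell Q) (mset_set (FixN Q \<inter> {x. x$3 = 0}))"

inductive poly_fn :: "((qmap \<times> (complex^3^4)) \<Rightarrow> complex) \<Rightarrow> bool" where
  pf_const: "poly_fn (\<lambda>_. c)"
| pf_coeff: "poly_fn (\<lambda>(Q,P). Q$i$j$k)"
| pf_point: "poly_fn (\<lambda>(Q,P). P$i$j)"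
| pf_add: "poly_fn p \<Longrightarrow> poly_fn q \<Longrightarrow> poly_fn (\<lambda>z. p z + q z)"
| pf_mult: "poly_fn p \<Longrightarrow> poly_fn q \<Longrightarrow> poly_fn (\<lambda>z. p z * q z)"

definition aut_ell :: "complex^3^3 \<Rightarrow> bool" where
  "aut_ell M \<longleftrightarrow> invertible M \<and> M$3$1 = 0 \<and> M$3$2 = 0"

end

theory Submission
  imports Defs "HOL-Computational_Algebra.Fundamental_Theorem_Algebra"
begin

text \<open>Since the line \<open>x$3 = 0\<close> is invariant, the third component of the quadratic map \<open>F\<close> is \<open>x$3 * L\<close>
  for a linear form \<open>L\<close>, so that \<open>W = F - L x\<close> takes values in the plane \<open>K\<close> given by \<open>x$3 = 0\<close>.
  Let \<open>\<tau>\<close> be the linear form tracing \<open>DW\<close> on \<open>K\<close>; generically \<open>L, \<tau>, x$3\<close> are coordinates.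
  A fixed vector of \<open>F\<close> on \<open>K\<close> has \<open>L = 1 - v\<close>, \<open>\<tau> = 3 v - u\<close> and \<open>W(q) = v q\<close>; there are three of them,
  and so the multipliers on the line determine the restriction of \<open>W\<close> to \<open>K\<close> in these coordinates.

  Off the line, the fixed vectors \<open>q\<^sub>i\<close> are zeros of \<open>W\<close> on \<open>L = 1\<close>, with \<open>t\<^sub>i = - \<tau>(q\<^sub>i)\<close> and
  \<open>d\<^sub>i = det DW(q\<^sub>i)\<close> on \<open>K\<close>. The Euler-Jacobi relations say that the vector \<open>z\<close> of their heights \<open>x$3\<close> is
  orthogonal to \<open>1\<close>, \<open>t\<close> and \<open>z\<close> for the form with weights \<open>1 / d\<^sub>i\<close>, and only two lines have this property.
  The coefficient of \<open>x$3\<close> in \<open>W\<close> is a trace-free endomorphism of \<open>K\<close>, and generically this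
  fails for the second line. Once the heights are known up to scaling, the seven fixed vectors
  determine \<open>W\<close>.\<close>

subsection \<open>Rational functions of a marked map\<close>

text \<open>One fraction has to serve on all of \<open>S\<close>, with a denominator free of zeros
  there, so that a zero of \<open>f\<close> in \<open>S\<close> is a zero of the polynomial
  numerator.\<close>

definition rat_on :: "(qmap \<times> (complex^3^4)) set \<Rightarrow> (qmap \<times> (complex^3^4) \<Rightarrow> complex) \<Rightarrow> bool" where
  "rat_on S f \<longleftrightarrow> (\<exists>p q. poly_fn p \<and> poly_fn q \<and> (\<forall>z\<in>S. q z \<noteq> 0 \<and> f z * q z = p z))"

lemma rat_onI:
  assumes "poly_fn p" "poly_fn q" "\<And>z. z \<in> S \<Longrightarrow> q z \<noteq> 0" "\<And>z. z \<in> S \<Longrightarrow> f z * q z = p z"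
  shows "rat_on S f"
  using assms unfolding rat_on_def by blast

lemma rat_on_poly: "poly_fn p \<Longrightarrow> rat_on S p"
  by (rule rat_onI[where q = "\<lambda>_. 1"]) (auto intro: pf_const)

lemma rat_on_const: "rat_on S (\<lambda>_. c)"
  by (rule rat_on_poly) (rule pf_const)

lemma rat_on_coeff: "rat_on S (\<lambda>z. fst z $ i $ j $ k)"
  using rat_on_poly[OF pf_coeff] by (simp add: case_prod_beta')

lemma rat_on_point: "rat_on S (\<lambda>z. snd z $ i $ j)"
  using rat_on_poly[OF pf_point] by (simp add: case_prod_beta')

lemma rat_on_add:
  assumes "rat_on S f" "rat_on S g" shows "rat_on S (\<lambda>z. f z + g z)"
proof -
  obtain p q p' q' where poly: "poly_fn p" "poly_fn q" "poly_fn p'" "poly_fn q'"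
    and eq: "\<forall>z\<in>S. q z \<noteq> 0 \<and> f z * q z = p z" "\<forall>z\<in>S. q' z \<noteq> 0 \<and> g z * q' z = p' z"
    using assms unfolding rat_on_def by blast
  show ?thesis
  proof (rule rat_onI)
    show "poly_fn (\<lambda>z. p z * q' z + p' z * q z)" "poly_fn (\<lambda>z. q z * q' z)"
      by (intro pf_add pf_mult poly)+
    fix z assume "z \<in> S"
    with eq have "q z \<noteq> 0" "q' z \<noteq> 0" and eq_z: "p z = f z * q z" "p' z = g z * q' z" by simp_all
    then show "q z * q' z \<noteq> 0" by simp
    show "(f z + g z) * (q z * q' z) = p z * q' z + p' z * q z"
      unfolding eq_z by (simp only: algebra_simps)
  qed
qed

lemma rat_on_mult:
  assumes "rat_on S f" "rat_on S g" shows "rat_on S (\<lambda>z. f z * g z)"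
proof -
  obtain p q p' q' where poly: "poly_fn p" "poly_fn q" "poly_fn p'" "poly_fn q'"
    and eq: "\<forall>z\<in>S. q z \<noteq> 0 \<and> f z * q z = p z" "\<forall>z\<in>S. q' z \<noteq> 0 \<and> g z * q' z = p' z"
    using assms unfolding rat_on_def by blast
  show ?thesis
  proof (rule rat_onI)
    show "poly_fn (\<lambda>z. p z * p' z)" "poly_fn (\<lambda>z. q z * q' z)"
      by (intro pf_mult poly)+
    fix z assume "z \<in> S"
    with eq have "q z \<noteq> 0" "q' z \<noteq> 0" and eq_z: "p z = f z * q z" "p' z = g z * q' z" by simp_all
    then show "q z * q' z \<noteq> 0" by simp
    show "f z * g z * (q z * q' z) = p z * p' z"
      unfolding eq_z by (simp only: ac_simps)
  qed
qed

lemma rat_on_diff: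
  assumes "rat_on S f" "rat_on S g" shows "rat_on S (\<lambda>z. f z - g z)"
  using rat_on_add[OF assms(1) rat_on_mult[OF rat_on_const[of S "-1"] assms(2)]] by simp

lemma rat_on_divide:
  assumes "rat_on S f" "rat_on S g" "\<And>z. z \<in> S \<Longrightarrow> g z \<noteq> 0" shows "rat_on S (\<lambda>z. f z / g z)"
proof -
  obtain p q where poly: "poly_fn p" "poly_fn q"
    and eq: "\<forall>z\<in>S. q z \<noteq> 0 \<and> g z * q z = p z"
    using assms(2) unfolding rat_on_def by blast
  have "rat_on S (\<lambda>z. 1 / g z)"
  proof (rule rat_onI[OF poly(2,1)])
    fix z assume z: "z \<in> S"
    with eq have eq_z: "q z \<noteq> 0" "p z = g z * q z" by simp_all
    show "p z \<noteq> 0" "1 / g z * p z = q z" using eq_z assms(3)[OF z] by simp_all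
  qed
  from rat_on_mult[OF assms(1) this] show ?thesis by simp
qed

lemma rat_on_sum: "finite A \<Longrightarrow> (\<And>a. a \<in> A \<Longrightarrow> rat_on S (f a)) \<Longrightarrow> rat_on S (\<lambda>z. \<Sum>a\<in>A. f a z)"
  by (induction A rule: finite_induct) (auto intro: rat_on_const rat_on_add)

lemma rat_on_nonvanishing:
  assumes "rat_on S f"
  obtains p where "poly_fn p" "\<And>z. z \<in> S \<Longrightarrow> p z \<noteq> 0 \<longleftrightarrow> f z \<noteq> 0"
  using assms unfolding rat_on_def by (metis mult_eq_0_iff)

subsection \<open>Linear algebra in dimension three\<close>

definition det3 :: "vec3 \<Rightarrow> vec3 \<Rightarrow> vec3 \<Rightarrow> complex" where
  "det3 x y z = x$1 * (y$2 * z$3 - y$3 * z$2) - x$2 * (y$1 * z$3 - y$3 * z$1)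
     + x$3 * (y$1 * z$2 - y$2 * z$1)"

lemma linear_3_zero:
  fixes a b c :: complex
  assumes "\<And>i::3. a * f i + b * g i + c * h i = 0"
    and "f 1 * (g 2 * h 3 - g 3 * h 2) - g 1 * (f 2 * h 3 - f 3 * h 2) + h 1 * (f 2 * g 3 - f 3 * g 2) \<noteq> 0"
      (is "?D \<noteq> 0")
  shows "a = 0 \<and> b = 0 \<and> c = 0"
proof -
  \<comment> \<open>Cramer's rule: combine the three equations with the cofactors of
    \<open>?D\<close>.\<close>
  have "a * ?D = 0" "b * ?D = 0" "c * ?D = 0"
    using assms(1)[of 1] assms(1)[of 2] assms(1)[of 3] by algebra+
  with assms(2) show ?thesis by simp
qed

text \<open>A nonzero binary quadratic form has at most two zeros on the projective line. The
  determinant of the conditions is a homogeneous Vandermonde determinant, the product of the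
  pairwise minors.\<close>

lemma binary_quadratic_zero:
  fixes a b c :: complex
  assumes "\<And>i::3. a * (f i)\<^sup>2 + b * (f i * g i) + c * (g i)\<^sup>2 = 0"
    and "\<And>i j. i \<noteq> j \<Longrightarrow> f i * g j \<noteq> f j * g i"
  shows "a = 0 \<and> b = 0 \<and> c = 0"
proof (rule linear_3_zero[OF assms(1)])
  have "(f 1 * g 2 - f 2 * g 1) * (f 1 * g 3 - f 3 * g 1) * (f 2 * g 3 - f 3 * g 2) \<noteq> 0"
    using assms(2)[of 1 2] assms(2)[of 1 3] assms(2)[of 2 3] by simp
  moreover have "(f 1 * g 2 - f 2 * g 1) * (f 1 * g 3 - f 3 * g 1) * (f 2 * g 3 - f 3 * g 2) =
    (f 1)\<^sup>2 * (f 2 * g 2 * (g 3)\<^sup>2 - f 3 * g 3 * (g 2)\<^sup>2) - f 1 * g 1 * ((f 2)\<^sup>2 * (g 3)\<^sup>2 - (f 3)\<^sup>2 * (g 2)\<^sup>2)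
     + (g 1)\<^sup>2 * ((f 2)\<^sup>2 * (f 3 * g 3) - (f 3)\<^sup>2 * (f 2 * g 2))"
    by (simp only: power2_eq_square algebra_simps)
  ultimately show "(f 1)\<^sup>2 * (f 2 * g 2 * (g 3)\<^sup>2 - f 3 * g 3 * (g 2)\<^sup>2) - f 1 * g 1 * ((f 2)\<^sup>2 * (g 3)\<^sup>2 - (f 3)\<^sup>2 * (g 2)\<^sup>2)
     + (g 1)\<^sup>2 * ((f 2)\<^sup>2 * (f 3 * g 3) - (f 3)\<^sup>2 * (f 2 * g 2)) \<noteq> 0"
    by simp
qed

lemma cramer_3:
  "det3 x y z *s w = det3 w y z *s x + det3 x w z *s y + det3 x y w *s z"
  by (simp add: vec_eq_iff forall_3 det3_def algebra_simps)

subsection \<open>The linear forms attached to a map preserving the line\<close>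

definition ell_form :: "qmap \<Rightarrow> vec3 \<Rightarrow> complex" where
  "ell_form Q x = (Q$3$1$3 + Q$3$3$1) * x$1 + (Q$3$2$3 + Q$3$3$2) * x$2 + Q$3$3$3 * x$3"

text \<open>The partial derivative of component \<open>i\<close> in direction \<open>j\<close>; both
  index orders occur because \<open>Q\<close> need not be symmetric.\<close>

definition deriv_q :: "qmap \<Rightarrow> 3 \<Rightarrow> 3 \<Rightarrow> vec3 \<Rightarrow> complex" where
  "deriv_q Q i j x = (\<Sum>k\<in>UNIV. (Q$i$j$k + Q$i$k$j) * x$k)"

definition transverse :: "qmap \<Rightarrow> vec3 \<Rightarrow> vec3" where
  "transverse Q x = qeval Q x - ell_form Q x *s x"

definition deriv_W :: "qmap \<Rightarrow> 3 \<Rightarrow> 3 \<Rightarrow> vec3 \<Rightarrow> complex" where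
  "deriv_W Q i j x = deriv_q Q i j x - (if i = j then ell_form Q x else 0) - x$i * ell_form Q (axis j 1)"

definition trace_form :: "qmap \<Rightarrow> vec3 \<Rightarrow> complex" where
  "trace_form Q x = deriv_W Q 1 1 x + deriv_W Q 2 2 x"

definition det_form :: "qmap \<Rightarrow> vec3 \<Rightarrow> complex" where
  "det_form Q x = deriv_W Q 1 1 x * deriv_W Q 2 2 x - deriv_W Q 1 2 x * deriv_W Q 2 1 x"

lemma ell_form_add: "ell_form Q (x + y) = ell_form Q x + ell_form Q y"
  and ell_form_scale: "ell_form Q (c *s x) = c * ell_form Q x"
  by (simp_all add: ell_form_def algebra_simps)

lemma deriv_W_add: "deriv_W Q i j (x + y) = deriv_W Q i j x + deriv_W Q i j y"
  and deriv_W_scale: "deriv_W Q i j (c *s x) = c * deriv_W Q i j x"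
  by (simp_all add: deriv_W_def deriv_q_def ell_form_add ell_form_scale sum_3 algebra_simps)

lemma trace_form_add: "trace_form Q (x + y) = trace_form Q x + trace_form Q y"
  and trace_form_scale: "trace_form Q (c *s x) = c * trace_form Q x"
  by (simp_all add: trace_form_def deriv_W_add deriv_W_scale algebra_simps)

lemma det_form_scale: "det_form Q (c *s x) = c\<^sup>2 * det_form Q x"
  by (simp add: det_form_def deriv_W_scale algebra_simps power2_eq_square)

lemma qeval_scale: "qeval Q (c *s x) = c\<^sup>2 *s qeval Q x"
  by (simp add: vec_eq_iff qeval_def sum_3 algebra_simps power2_eq_square)

lemma transverse_scale: "transverse Q (c *s x) = c\<^sup>2 *s transverse Q x"
  by (simp add: vec_eq_iff transverse_def qeval_scale ell_form_scale algebra_simps power2_eq_square)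

text \<open>Evaluate at (1:0:0), (0:1:0) and (1:1:0). Only the symmetric part of the coefficients is
  constrained, hence the sign in the last equation.\<close>

lemma preserves_ell_coeffs:
  assumes "preserves_ell Q"
  shows "Q$3$1$1 = 0" "Q$3$2$2 = 0" "Q$3$2$1 = - Q$3$1$2"
proof -
  have *: "qeval Q (vector [a,b,0]) $ 3 = 0" for a b
    using assms by (simp add: preserves_ell_def)
  show 1: "Q$3$1$1 = 0" using *[of 1 0] by (simp add: qeval_def sum_3)
  show 2: "Q$3$2$2 = 0" using *[of 0 1] by (simp add: qeval_def sum_3)
  show "Q$3$2$1 = - Q$3$1$2" using *[of 1 1] 1 2
    by (simp add: qeval_def sum_3 eq_neg_iff_add_eq_0 add.commute)
qed

lemma qeval_3: "preserves_ell Q \<Longrightarrow> qeval Q x $ 3 = x$3 * ell_form Q x"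
  using preserves_ell_coeffs[of Q] by (simp add: qeval_def sum_3 ell_form_def algebra_simps)

lemma transverse_3: "preserves_ell Q \<Longrightarrow> transverse Q x $ 3 = 0"
  by (simp add: transverse_def qeval_3)

lemma euler: "deriv_q Q i 1 x * x$1 + deriv_q Q i 2 x * x$2 + deriv_q Q i 3 x * x$3 = 2 * qeval Q x $ i"
  by (simp add: deriv_q_def qeval_def sum_3 algebra_simps)

lemma qeval_axis_expand:
  "qeval Q (y + s *s axis j 1) $ i = qeval Q y $ i + s * deriv_q Q i j y + s\<^sup>2 * Q$i$j$j"
  using exhaust_3[of j] by (auto simp: qeval_def deriv_q_def sum_3 axis_def algebra_simps power2_eq_square)

section \<open>Derivatives and multipliers at fixed points\<close>

lemma chart_idx_nonzero: "x \<noteq> 0 \<Longrightarrow> x $ chart_idx x \<noteq> 0"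
  by (auto simp: chart_idx_def vec_eq_iff forall_3)

lemma deriv_q_scale: "deriv_q Q i j (c *s x) = c * deriv_q Q i j x"
  by (simp add: deriv_q_def sum_3 algebra_simps)

text \<open>The quotient rule at the normalized point. Partial derivatives and multiplier both scale
  linearly with the representative, so the result can be written with \<open>x\<close>
  itself.\<close>

lemma jac_fixed:
  assumes fx: "qeval Q x = c *s x" and "c \<noteq> 0" "x \<noteq> 0"
  defines "k \<equiv> chart_idx x"
  shows "jac Q x i j = (deriv_q Q i j x - x$i / x$k * deriv_q Q k j x) / c"
proof -
  define y where "y = normalize3 x"
  have xk: "x$k \<noteq> 0" using chart_idx_nonzero assms by simp
  have y: "y = (1 / x$k) *s x" by (simp add: y_def normalize3_def k_def)
  have yk: "y$k = 1" using xk by (simp add: y)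
  have qy: "qeval Q y $ l = c / x$k * y$l" for l
    using xk by (simp add: y qeval_scale fx power2_eq_square)
  have fun_eq: "chart_map Q k (y + s *s axis j 1) $ i =
      (qeval Q y $ i + s * deriv_q Q i j y + s\<^sup>2 * Q$i$j$j) / (qeval Q y $ k + s * deriv_q Q k j y + s\<^sup>2 * Q$k$j$j)" for s
    by (simp add: chart_map_def qeval_axis_expand)
  have nz: "qeval Q y $ k \<noteq> 0" using xk \<open>c \<noteq> 0\<close> by (simp add: qy yk)
  have "((\<lambda>s. chart_map Q k (y + s *s axis j 1) $ i) has_field_derivative
      (deriv_q Q i j y * qeval Q y $ k - qeval Q y $ i * deriv_q Q k j y) / (qeval Q y $ k)\<^sup>2) (at 0)"
    unfolding fun_eq using nz
    by (auto intro!: derivative_eq_intros simp: power2_eq_square)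
  then have "jac Q x i j = (deriv_q Q i j y * qeval Q y $ k - qeval Q y $ i * deriv_q Q k j y) / (qeval Q y $ k)\<^sup>2"
    unfolding jac_def k_def[symmetric] y_def[symmetric] by (rule DERIV_imp_deriv)
  also have "\<dots> = (deriv_q Q i j x - x$i / x$k * deriv_q Q k j x) / c"
    using xk \<open>c \<noteq> 0\<close> unfolding qy yk unfolding y
    by (simp add: deriv_q_scale field_simps power2_eq_square)
  finally show ?thesis .
qed

lemma fixed_multiplier:
  assumes "holo_quad Q" "is_fixed Q x"
  obtains c where "c \<noteq> 0" "qeval Q x = c *s x"
  using assms unfolding is_fixed_def holo_quad_def by (metis vector_smult_lzero)

lemma deriv_q_3:
  assumes "preserves_ell Q"
  shows "deriv_q Q 3 j x = x$3 * ell_form Q (axis j 1) + (if j = 3 then ell_form Q x else 0)"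
  using preserves_ell_coeffs[OF assms] exhaust_3[of j]
  by (auto simp: deriv_q_def sum_3 ell_form_def axis_def algebra_simps)

lemma ell_form_expand: "ell_form Q x = ell_form Q (axis 1 1) * x$1 + ell_form Q (axis 2 1) * x$2 + ell_form Q (axis 3 1) * x$3"
  by (simp add: ell_form_def axis_def)

lemma chart_cases:
  obtains "chart_idx x = 1" "x$1 \<noteq> 0" | "chart_idx x = 2" "x$1 = 0" "x$2 \<noteq> 0"
  | "chart_idx x = 3" "x$1 = 0" "x$2 = 0"
  unfolding chart_idx_def by (metis (full_types))

text \<open>The tangent space is the ambient space modulo \<open>x\<close>, identified with
  \<open>K\<close> because \<open>x$3 \<noteq> 0\<close>. Modulo \<open>x\<close>, \<open>DF\<close>
  is \<open>DW + L\<close>, so \<open>I - Df\<close> acts as \<open>- DW / L\<close>; in dimension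
  two the sign survives in the trace only.\<close>

lemma tr_det_off_ell:
  assumes Q: "preserves_ell Q" and fx: "qeval Q x = ell_form Q x *s x" and L0: "ell_form Q x \<noteq> 0" and x3: "x$3 \<noteq> 0"
  shows "tr_IDf Q x = - trace_form Q x / ell_form Q x" "det_IDf Q x = det_form Q x / (ell_form Q x)\<^sup>2"
proof -
  define F where "F i j = deriv_q Q i j x" for i j
  define c where "c = ell_form Q x"
  define l where "l j = ell_form Q (axis j 1)" for j
  have c: "c = l 1 * x$1 + l 2 * x$2 + l 3 * x$3" unfolding c_def l_def by (rule ell_form_expand)
  have e: "F 1 1 * x$1 + F 1 2 * x$2 + F 1 3 * x$3 = 2 * c * x$1"
    "F 2 1 * x$1 + F 2 2 * x$2 + F 2 3 * x$3 = 2 * c * x$2"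
    using euler[of Q 1 x] euler[of Q 2 x] by (simp_all add: F_def c_def fx)
  have F3: "F 3 1 = x$3 * l 1" "F 3 2 = x$3 * l 2" "F 3 3 = x$3 * l 3 + c"
    by (simp_all add: F_def l_def c_def deriv_q_3[OF Q])
  have x0: "x \<noteq> 0" using x3 by auto
  have c0: "c \<noteq> 0" using L0 by (simp add: c_def)
  note jac = jac_fixed[OF fx L0 x0, folded F_def c_def]
  have tr: "trace_form Q x = F 1 1 + F 2 2 - 2 * c - x$1 * l 1 - x$2 * l 2"
    by (simp add: trace_form_def deriv_W_def F_def c_def l_def)
  have det: "det_form Q x = (F 1 1 - c - x$1 * l 1) * (F 2 2 - c - x$2 * l 2) - (F 1 2 - x$1 * l 2) * (F 2 1 - x$2 * l 1)"
    by (simp add: det_form_def deriv_W_def F_def c_def l_def)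
  \<comment> \<open>Euler's identity and the expansion of \<open>L\<close> express direction 3
    through directions 1 and 2, which makes the charts comparable.\<close>
  have F13: "F 1 3 = (2 * c * x$1 - F 1 1 * x$1 - F 1 2 * x$2) / x$3"
    and F23: "F 2 3 = (2 * c * x$2 - F 2 1 * x$1 - F 2 2 * x$2) / x$3"
    and l3: "l 3 = (c - l 1 * x$1 - l 2 * x$2) / x$3"
    using e c x3 by (simp_all add: field_simps)
  have "tr_IDf Q x = - trace_form Q x / c \<and> det_IDf Q x = det_form Q x / c\<^sup>2"
  proof (cases x rule: chart_cases)
    case 1
    have "tr_IDf Q x = - trace_form Q x / c"
      unfolding tr_IDf_def chart_coords_def 1(1) tr using 1(2) c0 x3
      by (simp add: jac 1(1) F3 F13 F23 l3 field_simps)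
    moreover have "det_IDf Q x = det_form Q x / c\<^sup>2"
      unfolding det_IDf_def chart_coords_def 1(1) det using 1(2) c0 x3
      by (simp add: jac 1(1) F3 F13 F23 l3 field_simps power2_eq_square)
    ultimately show ?thesis ..
  next
    case 2
    have "tr_IDf Q x = - trace_form Q x / c"
      unfolding tr_IDf_def chart_coords_def 2(1) tr using 2(2,3) c0 x3
      by (simp add: jac 2(1) F3 F13 F23 l3 field_simps)
    moreover have "det_IDf Q x = det_form Q x / c\<^sup>2"
      unfolding det_IDf_def chart_coords_def 2(1) det using 2(2,3) c0 x3
      by (simp add: jac 2(1) F3 F13 F23 l3 field_simps power2_eq_square)
    ultimately show ?thesis ..
  next
    case 3
    have "tr_IDf Q x = - trace_form Q x / c"
      unfolding tr_IDf_def chart_coords_def 3(1) tr using 3(2,3) c0 x3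
      by (simp add: jac 3(1) F3 F13 F23 l3 field_simps)
    moreover have "det_IDf Q x = det_form Q x / c\<^sup>2"
      unfolding det_IDf_def chart_coords_def 3(1) det using 3(2,3) c0 x3
      by (simp add: jac 3(1) F3 F13 F23 l3 field_simps power2_eq_square)
    ultimately show ?thesis ..
  qed
  then show "tr_IDf Q x = - trace_form Q x / ell_form Q x" "det_IDf Q x = det_form Q x / (ell_form Q x)\<^sup>2"
    by (simp_all add: c_def)
qed

text \<open>On \<open>K\<close>, \<open>DF\<close> has eigenvalue \<open>2 * c\<close> at
  \<open>x\<close> by Euler's identity and \<open>(1 - u) * c\<close> modulo \<open>x\<close>, hence
  trace \<open>(3 - u) * c\<close>; subtracting \<open>3 * L\<close> with
  \<open>L = (1 - v) * c\<close> gives \<open>\<tau>\<close>. Invariance of the line makes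
  \<open>I - Df\<close> triangular.\<close>

lemma multipliers_on_ell:
  assumes Q: "preserves_ell Q" and fx: "qeval Q x = c *s x" and c0: "c \<noteq> 0" and x0: "x \<noteq> 0" and x3: "x$3 = 0"
  shows "ell_form Q x / c = 1 - snd (uv_ell Q x)"
    and "trace_form Q x / c = 3 * snd (uv_ell Q x) - fst (uv_ell Q x)"
    and "det_IDf Q x = fst (uv_ell Q x) * snd (uv_ell Q x)"
proof -
  define F where "F i j = deriv_q Q i j x" for i j
  define l where "l j = ell_form Q (axis j 1)" for j
  have L: "ell_form Q x = l 1 * x$1 + l 2 * x$2" unfolding l_def using ell_form_expand[of Q x] x3 by simp
  have e: "F 1 1 * x$1 + F 1 2 * x$2 = 2 * c * x$1" "F 2 1 * x$1 + F 2 2 * x$2 = 2 * c * x$2"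
    using euler[of Q 1 x] euler[of Q 2 x] x3 by (simp_all add: F_def fx)
  have F3: "F 3 1 = 0" "F 3 2 = 0" "F 3 3 = ell_form Q x"
    by (simp_all add: F_def deriv_q_3[OF Q] x3)
  note jac = jac_fixed[OF fx c0 x0, folded F_def]
  have tr: "trace_form Q x = F 1 1 + F 2 2 - 3 * ell_form Q x"
    using L by (simp add: trace_form_def deriv_W_def F_def l_def mult.commute)
  have "ell_form Q x / c = 1 - snd (uv_ell Q x) \<and> trace_form Q x / c = 3 * snd (uv_ell Q x) - fst (uv_ell Q x)
      \<and> det_IDf Q x = fst (uv_ell Q x) * snd (uv_ell Q x)"
  proof (cases x rule: chart_cases)
    case 1
    then have "F 1 1 = (2 * c * x$1 - F 1 2 * x$2) / x$1" using e by (simp add: field_simps)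
    then show ?thesis using 1(2) c0
      apply (simp add: uv_ell_def det_IDf_def chart_coords_def 1(1) jac F3 x3 tr field_simps)
      using e(1) by algebra
  next
    case 2
    then have "F 2 2 = 2 * c" using e by simp
    then show ?thesis using 2(2,3) c0
      by (simp add: uv_ell_def det_IDf_def chart_coords_def 2(1) jac F3 x3 tr field_simps)
  next
    case 3
    with x0 x3 show ?thesis by (simp add: vec_eq_iff forall_3)
  qed
  then show "ell_form Q x / c = 1 - snd (uv_ell Q x)"
    and "trace_form Q x / c = 3 * snd (uv_ell Q x) - fst (uv_ell Q x)"
    and "det_IDf Q x = fst (uv_ell Q x) * snd (uv_ell Q x)"
    by blast+
qed

section \<open>Polarization of \<open>W\<close> and the Euler-Jacobi relation\<close>

definition polar :: "qmap \<Rightarrow> vec3 \<Rightarrow> vec3 \<Rightarrow> vec3" where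
  "polar Q x y = transverse Q (x + y) - transverse Q x - transverse Q y"

lemma polar_commute: "polar Q x y = polar Q y x"
  by (simp add: polar_def add.commute)

lemma polar_add_right: "polar Q x (y + y') = polar Q x y + polar Q x y'"
  by (simp add: vec_eq_iff polar_def transverse_def ell_form_def qeval_def sum_3 algebra_simps)

lemma polar_scale_right: "polar Q x (c *s y) = c *s polar Q x y"
  by (simp add: vec_eq_iff polar_def transverse_def ell_form_def qeval_def sum_3 algebra_simps)

lemma polar_add_left: "polar Q (x + x') y = polar Q x y + polar Q x' y"
  and polar_scale_left: "polar Q (c *s x) y = c *s polar Q x y"
  using polar_add_right polar_scale_right polar_commute by metis+

lemma polar_self: "polar Q x x = 2 *s transverse Q x"
  by (simp add: vec_eq_iff polar_def transverse_def ell_form_def qeval_def sum_3 algebra_simps)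

lemma transverse_add: "transverse Q (x + y) = transverse Q x + transverse Q y + polar Q x y"
  by (simp add: polar_def)

lemma polar_deriv_W:
  assumes "y$3 = 0" "i = 1 \<or> i = 2"
  shows "polar Q x y $ i = deriv_W Q i 1 x * y$1 + deriv_W Q i 2 x * y$2"
  using assms
  by (auto simp: polar_def transverse_def deriv_W_def deriv_q_def ell_form_def qeval_def sum_3 axis_def algebra_simps)

definition wedge :: "vec3 \<Rightarrow> vec3 \<Rightarrow> complex" where
  "wedge x y = x$1 * y$2 - x$2 * y$1"

text \<open>The linear map \<open>polar Q q\<close> kills \<open>q\<close>, so it factors through
  the projection to \<open>K\<close> along \<open>q\<close>, and on \<open>K\<close> it is
  \<open>DW(q)\<close>. Compare area forms.\<close>

lemma det_form_polar:
  assumes "transverse Q q = 0" "q$3 \<noteq> 0"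
  shows "det_form Q q * det3 q x y = q$3 * wedge (polar Q q x) (polar Q q y)"
proof -
  \<comment> \<open>A projection to \<open>K\<close> along \<open>q\<close> without denominators; it
    multiplies vectors of \<open>K\<close> by \<open>- q$3\<close>.\<close>
  define k where "k v = v$3 *s q + (- q$3) *s v" for v :: vec3
  have k3: "k v $ 3 = 0" for v by (simp add: k_def)
  have "polar Q q (k v) = (- q$3) *s polar Q q v" for v
    by (simp only: k_def polar_add_right polar_scale_right polar_self assms(1)) simp
  then have bk: "- q$3 * polar Q q v $ i = deriv_W Q i 1 q * k v $ 1 + deriv_W Q i 2 q * k v $ 2"
    if "i = 1 \<or> i = 2" for v i
    using polar_deriv_W[OF k3 that, of Q q v] by simp
  have "(q$3)\<^sup>2 * wedge (polar Q q x) (polar Q q y) =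
      (- q$3 * polar Q q x $ 1) * (- q$3 * polar Q q y $ 2) - (- q$3 * polar Q q x $ 2) * (- q$3 * polar Q q y $ 1)"
    by (simp add: wedge_def power2_eq_square algebra_simps)
  also have "\<dots> = det_form Q q * (k x $ 1 * k y $ 2 - k x $ 2 * k y $ 1)"
    by (simp only: bk simp_thms det_form_def) (simp add: algebra_simps)
  also have "k x $ 1 * k y $ 2 - k x $ 2 * k y $ 1 = q$3 * det3 q x y"
    by (simp add: k_def det3_def algebra_simps)
  finally show ?thesis using assms(2) by (simp add: power2_eq_square)
qed

text \<open>Since \<open>W\<close> vanishes at all four vectors, expanding \<open>W(q4)\<close>
  leaves a linear relation between \<open>u\<close>, \<open>v\<close> and \<open>w\<close>. It makes
  suitable multiples of their wedge products equal, and \<open>det_form_polar\<close> turns these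
  into the values of \<open>det_form\<close>.\<close>

lemma euler_jacobi_dependency:
  assumes W: "transverse Q q1 = 0" "transverse Q q2 = 0" "transverse Q q3 = 0" "transverse Q q4 = 0"
    and z: "q1$3 \<noteq> 0" "q2$3 \<noteq> 0" "q3$3 \<noteq> 0" "q4$3 \<noteq> 0"
    and q4: "q4 = a1 *s q1 + a2 *s q2 + a3 *s q3" and a: "a1 \<noteq> 0" "a2 \<noteq> 0" "a3 \<noteq> 0"
    and D: "det3 q1 q2 q3 \<noteq> 0"
  shows "\<exists>m. det_form Q q1 * a1 = m * q1$3 \<and> det_form Q q2 * a2 = m * q2$3 \<and> det_form Q q3 * a3 = m * q3$3
    \<and> - det_form Q q4 = m * q4$3"
proof -
  define D where "D = det3 q1 q2 q3"
  define u v w where "u = polar Q q1 q2" and "v = polar Q q1 q3" and "w = polar Q q2 q3"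
  define m where "m = a1 * wedge u v"
  have b4: "polar Q q4 q1 = a2 *s u + a3 *s v" "polar Q q4 q2 = a1 *s u + a3 *s w" "polar Q q4 q3 = a1 *s v + a2 *s w"
    by (simp_all add: q4 polar_add_left polar_scale_left polar_self W u_def v_def w_def polar_commute[of Q q2 q1]
        polar_commute[of Q q3])
  have "polar Q q4 q4 = a1 *s polar Q q4 q1 + a2 *s polar Q q4 q2 + a3 *s polar Q q4 q3"
    by (subst (2) q4) (simp add: polar_add_right polar_scale_right)
  then have "a1 *s (a2 *s u + a3 *s v) + a2 *s (a1 *s u + a3 *s w) + a3 *s (a1 *s v + a2 *s w) = 0"
    by (simp add: polar_self W b4)
  then have "2 * (a1 * a2 * u$i + a1 * a3 * v$i + a2 * a3 * w$i) = 0" for i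
    by (simp add: vec_eq_iff algebra_simps)
  then have rel: "a1 * a2 * u$i + a1 * a3 * v$i + a2 * a3 * w$i = 0" for i
    by (metis mult_eq_0_iff zero_neq_numeral)
  \<comment> \<open>The relation wedged with \<open>u\<close> and with \<open>v\<close>.\<close>
  have "a3 * (a1 * wedge u v) = a3 * (a2 * wedge w u)" "a2 * (a1 * wedge u v) = a2 * (a3 * wedge v w)"
    using rel[of 1] rel[of 2] unfolding wedge_def by algebra+
  then have m: "a2 * wedge w u = m" "a3 * wedge v w = m" using a by (simp_all add: m_def)
  have "det_form Q q1 * D = q1$3 * wedge u v"
    using det_form_polar[OF W(1) z(1), of q2 q3] by (simp add: D_def u_def v_def)
  then have 1: "D * (det_form Q q1 * a1) = D * (m / D * q1$3)"
    using D by (simp add: D_def m_def ac_simps)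
  have "det_form Q q2 * D = q2$3 * wedge w u"
    using det_form_polar[OF W(2) z(2), of q3 q1] by (simp add: D_def w_def u_def det3_def polar_commute[of Q q2 q1] algebra_simps)
  then have 2: "D * (det_form Q q2 * a2) = D * (m / D * q2$3)"
    using D by (simp add: D_def ac_simps flip: m(1))
  have "det_form Q q3 * D = q3$3 * wedge v w"
    using det_form_polar[OF W(3) z(3), of q1 q2] by (simp add: D_def v_def w_def det3_def polar_commute[of Q q3] algebra_simps)
  then have 3: "D * (det_form Q q3 * a3) = D * (m / D * q3$3)"
    using D by (simp add: D_def ac_simps flip: m(2))
  have "det3 q4 q1 q2 = a3 * D"
    by (simp add: q4 D_def det3_def algebra_simps)
  moreover have "wedge (polar Q q4 q1) (polar Q q4 q2) = - a3 * (a2 * wedge w u) - a3 * (a1 * wedge u v) + a3 * (a3 * wedge v w)"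
    unfolding b4 by (simp add: wedge_def algebra_simps)
  ultimately have "det_form Q q4 * (a3 * D) = q4$3 * (- a3 * m)"
    using det_form_polar[OF W(4) z(4), of q1 q2] by (simp add: m flip: m_def)
  then have "a3 * (D * - det_form Q q4) = a3 * (D * (m / D * q4$3))"
    using D by (simp add: D_def algebra_simps)
  then have "D * - det_form Q q4 = D * (m / D * q4$3)"
    using a(3) unfolding mult_cancel_left by blast
  with 1 2 3 D show ?thesis unfolding D_def[symmetric] mult_cancel_left by blast
qed

text \<open>The linear dependency of the four zeros is unique up to scaling, with nonzero
  coefficients by the minors; by the previous lemma they are proportional to the weights in this
  sum.\<close>

lemma euler_jacobi:
  fixes q :: "vec3^4"
  assumes W: "\<And>i. transverse Q (q$i) = 0" and z: "\<And>i. q$i$3 \<noteq> 0" and d: "\<And>i. det_form Q (q$i) \<noteq> 0"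
    and D: "det3 (q$1) (q$2) (q$3) \<noteq> 0" "det3 (q$4) (q$2) (q$3) \<noteq> 0"
      "det3 (q$1) (q$4) (q$3) \<noteq> 0" "det3 (q$1) (q$2) (q$4) \<noteq> 0"
  shows "(\<Sum>i\<in>UNIV. (q$i$3 / det_form Q (q$i)) *s q$i) = 0"
proof -
  define D where "D = det3 (q$1) (q$2) (q$3)"
  \<comment> \<open>Cramer coefficients of \<open>q$4\<close>; the entry \<open>- 1\<close> turns
    its expansion into a dependency of all four vectors.\<close>
  define a where "a i = (if i = 1 then det3 (q$4) (q$2) (q$3) / D else if i = 2 then det3 (q$1) (q$4) (q$3) / D
    else if i = 3 then det3 (q$1) (q$2) (q$4) / D else - 1)" for i :: 4
  have q4: "q$4 = a 1 *s q$1 + a 2 *s q$2 + a 3 *s q$3"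
    using arg_cong[OF cramer_3[of "q$1" "q$2" "q$3" "q$4"], of "(*s) (1/D)"] D(1)
    by (simp add: a_def D_def vector_add_ldistrib)
  have a0: "a i \<noteq> 0" for i using D exhaust_4[of i] by (auto simp: a_def D_def)
  obtain m where m: "det_form Q (q$1) * a 1 = m * q$1$3" "det_form Q (q$2) * a 2 = m * q$2$3"
      "det_form Q (q$3) * a 3 = m * q$3$3" "- det_form Q (q$4) = m * q$4$3"
    using euler_jacobi_dependency[OF W W W W z z z z q4 a0 a0 a0 D(1)] by blast
  have a4: "a 4 = - 1" by (simp add: a_def)
  have m_all: "det_form Q (q$i) * a i = m * q$i$3" for i
    using m a4 exhaust_4[of i] by auto
  have "m \<noteq> 0" using m(4) d[of 4] by auto
  have "q$i$3 / det_form Q (q$i) = a i / m" for i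
    using m_all[of i] d[of i] \<open>m \<noteq> 0\<close> by (simp add: field_simps)
  then have "(\<Sum>i\<in>UNIV. (q$i$3 / det_form Q (q$i)) *s q$i) = (1/m) *s (\<Sum>i\<in>UNIV. a i *s q$i)"
    by (simp add: sum_4 vector_add_ldistrib)
  also have "(\<Sum>i\<in>UNIV. a i *s q$i) = 0"
    by (simp add: sum_4 a4 q4)
  finally show ?thesis by simp
qed

subsection \<open>Isotropic vectors\<close>

text \<open>On the first three indices this is, up to sign, the cross product of (1, 1, 1) and
  \<open>s\<close>, hence orthogonal to both.\<close>

definition gap :: "(4 \<Rightarrow> complex) \<Rightarrow> 4 \<Rightarrow> complex" where
  "gap s i = (if i = 1 then s 2 - s 3 else if i = 2 then s 3 - s 1 else if i = 3 then s 1 - s 2 else 0)"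

text \<open>The second isotropic line in the plane orthogonal to \<open>1\<close> and \<open>s\<close>, given the first isotropic vector \<open>z\<close>:
  the plane is spanned by \<open>z\<close> and \<open>d i * gap s i\<close>.\<close>

definition conj_root :: "(4 \<Rightarrow> complex) \<Rightarrow> (4 \<Rightarrow> complex) \<Rightarrow> (4 \<Rightarrow> complex) \<Rightarrow> 4 \<Rightarrow> complex" where
  "conj_root s d z i = 2 * (\<Sum>j\<in>UNIV. z j * gap s j) * d i * gap s i - (\<Sum>j\<in>UNIV. d j * (gap s j)\<^sup>2) * z i"

lemma gap_simps: "gap s 1 = s 2 - s 3" "gap s 2 = s 3 - s 1" "gap s 3 = s 1 - s 2" "gap s 4 = 0"
  by (simp_all add: gap_def)

text \<open>The vectors orthogonal to \<open>1\<close> and \<open>s\<close> for the form with weights \<open>1 / d\<close> form a plane,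
  which has only two isotropic lines.\<close>

lemma isotropic_alternative:
  fixes s d z z' :: "4 \<Rightarrow> complex"
  assumes d: "\<And>i. d i \<noteq> 0" and z0: "z 4 \<noteq> 0" "z' 4 \<noteq> 0"
    and D: "(\<Sum>j\<in>UNIV. z j * gap s j) \<noteq> 0"
    and z: "(\<Sum>i\<in>UNIV. z i / d i) = 0" "(\<Sum>i\<in>UNIV. s i * z i / d i) = 0" "(\<Sum>i\<in>UNIV. z i * z i / d i) = 0"
    and z': "(\<Sum>i\<in>UNIV. z' i / d i) = 0" "(\<Sum>i\<in>UNIV. s i * z' i / d i) = 0" "(\<Sum>i\<in>UNIV. z' i * z' i / d i) = 0"
  shows "\<exists>k. k \<noteq> 0 \<and> ((\<forall>i. z' i = k * z i) \<or> (\<forall>i. z' i = k * conj_root s d z i))"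
proof -
  \<comment> \<open>Subtracting this multiple of \<open>z\<close> kills the fourth entry. Then
    \<open>w\<close> lives on three indices, is orthogonal to \<open>1\<close> and \<open>s\<close>,
    and must be a multiple of \<open>gap s\<close>.\<close>
  define l where "l = z' 4 / z 4"
  define w where "w i = (z' i - l * z i) / d i" for i
  define D where "D = (\<Sum>j\<in>UNIV. z j * gap s j)"
  define Y where "Y = (\<Sum>j\<in>UNIV. d j * (gap s j)\<^sup>2)"
  define r where "r = (\<Sum>j\<in>UNIV. w j * z j) / D"
  have D0: "D \<noteq> 0" using assms(4) by (simp add: D_def)
  have l0: "l \<noteq> 0" using z0 by (simp add: l_def)
  have w4: "w 4 = 0" using z0 by (simp add: w_def l_def)
  have "(\<Sum>i\<in>UNIV. w i) = 0"
    using z(1) z'(1) by (simp add: w_def diff_divide_distrib sum_subtractf flip: sum_distrib_left times_divide_eq_right)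
  then have w1: "w 1 + w 2 + w 3 = 0" by (simp add: sum_4 w4)
  have "(\<Sum>i\<in>UNIV. s i * w i) = (\<Sum>i\<in>UNIV. s i * z' i / d i) - l * (\<Sum>i\<in>UNIV. s i * z i / d i)"
    by (simp add: w_def diff_divide_distrib sum_subtractf sum_distrib_left algebra_simps)
  then have ws: "s 1 * w 1 + s 2 * w 2 + s 3 * w 3 = 0" using z(2) z'(2) by (simp add: sum_4 w4)
  have wD: "(\<Sum>j\<in>UNIV. w j * z j) = w 1 * z 1 + w 2 * z 2 + w 3 * z 3"
    "D = z 1 * (s 2 - s 3) + z 2 * (s 3 - s 1) + z 3 * (s 1 - s 2)"
    by (simp_all add: D_def sum_4 w4 gap_simps)
  have "w 1 * D = (\<Sum>j\<in>UNIV. w j * z j) * gap s 1" "w 2 * D = (\<Sum>j\<in>UNIV. w j * z j) * gap s 2"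
    "w 3 * D = (\<Sum>j\<in>UNIV. w j * z j) * gap s 3"
    unfolding wD gap_simps using w1 ws by algebra+
  then have "w i * D = (\<Sum>j\<in>UNIV. w j * z j) * gap s i" for i
    using exhaust_4[of i] by (auto simp: w4 gap_simps)
  then have wr: "w i = r * gap s i" for i
    using D0 by (simp add: r_def field_simps)
  have zw: "z' i = l * z i + r * (d i * gap s i)" for i
    using wr[of i] d[of i] by (simp add: w_def field_simps)
  have "z' i * z' i / d i = l\<^sup>2 * (z i * z i / d i) + (2 * l * r) * (z i * gap s i) + r\<^sup>2 * (d i * (gap s i)\<^sup>2)" for i
    using d[of i] unfolding zw by (simp add: field_simps power2_eq_square)
  \<comment> \<open>Isotropy of \<open>z'\<close>. The first sum vanishes because \<open>z\<close>
    is isotropic, so the equation factors, and \<open>r = 0\<close> is the line of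
    \<open>z\<close>.\<close>
  then have "0 = l\<^sup>2 * (\<Sum>i\<in>UNIV. z i * z i / d i) + (2 * l * r) * D + r\<^sup>2 * Y"
    using z'(3) unfolding D_def Y_def by (simp only: sum.distrib sum_distrib_left)
  then have "r * (2 * l * D + r * Y) = 0"
    using z(3) by (simp add: algebra_simps power2_eq_square)
  then consider "r = 0" | "r \<noteq> 0" "2 * l * D + r * Y = 0" by auto
  then show ?thesis
  proof cases
    case 1
    then show ?thesis using zw l0 by auto
  next
    case 2
    then have l: "l = - r * Y / (2 * D)" using D0 by (simp add: field_simps eq_neg_iff_add_eq_0)
    have "z' i = r / (2 * D) * conj_root s d z i" for i
      unfolding zw l conj_root_def D_def[symmetric] Y_def[symmetric] using D0 by (simp add: field_simps)
    then show ?thesis using 2(1) D0 by (intro exI[of _ "r / (2 * D)"]) auto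
  qed
qed

text \<open>With \<open>p, p'\<close> the values of \<open>W\<close> on \<open>K\<close> below three of its zeros at heights \<open>z\<close>, Cramer's rule
  recovers from them the coefficient of \<open>x$3\<close> in \<open>W\<close>; its trace has this numerator.\<close>

definition obstruction :: "(4 \<Rightarrow> complex) \<Rightarrow> (4 \<Rightarrow> complex) \<Rightarrow> (4 \<Rightarrow> complex) \<Rightarrow> (4 \<Rightarrow> complex) \<Rightarrow> complex" where
  "obstruction s p p' z = z 2 * z 3 * (p 1 * (s 2 * z 3 - s 3 * z 2) + p' 1 * (z 2 - z 3))
    + z 3 * z 1 * (p 2 * (s 3 * z 1 - s 1 * z 3) + p' 2 * (z 3 - z 1))
    + z 1 * z 2 * (p 3 * (s 1 * z 2 - s 2 * z 1) + p' 3 * (z 1 - z 2))"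

lemma obstruction_scale: "obstruction s p p' (\<lambda>i. k * z i) = k ^ 3 * obstruction s p p' z"
  unfolding obstruction_def by algebra

text \<open>For nonzero heights, divide by \<open>z 1 * z 2 * z 3\<close>: the terms with
  \<open>p\<close> extract the constant coefficient and those with \<open>p'\<close> the coefficient
  of \<open>s\<close>, both times the determinant with rows \<open>(1, s i, z i)\<close>. The
  opposite coefficients \<open>a\<close> and \<open>- a\<close> cancel.\<close>

lemma obstruction_zero:
  assumes "\<And>i. p i = - z i * (a + b * s i + c * z i)" "\<And>i. p' i = - z i * (a' - a * s i + c' * z i)"
  shows "obstruction s p p' z = 0"
  unfolding obstruction_def assms by algebra

subsection \<open>The normal form\<close>

text \<open>The determinant of the linear forms \<open>L\<close>, \<open>\<tau>\<close> and
  \<open>x$3\<close>, the last of which has only one nonzero coefficient.\<close>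

definition frame_det :: "qmap \<Rightarrow> complex" where
  "frame_det Q = ell_form Q (axis 1 1) * trace_form Q (axis 2 1) - ell_form Q (axis 2 1) * trace_form Q (axis 1 1)"

text \<open>The inverse coordinate change by Cramer's rule: the vector with \<open>L = X\<close>,
  \<open>\<tau> = Y\<close> and height \<open>Z\<close>.\<close>

definition frame_vec :: "qmap \<Rightarrow> complex \<Rightarrow> complex \<Rightarrow> complex \<Rightarrow> vec3" where
  "frame_vec Q X Y Z = (let l = (\<lambda>j. ell_form Q (axis j 1)); t = (\<lambda>j. trace_form Q (axis j 1)) in
    vector [(t 2 * X - l 2 * Y + (l 2 * t 3 - l 3 * t 2) * Z) / frame_det Q,
            (l 1 * Y - t 1 * X + (l 3 * t 1 - l 1 * t 3) * Z) / frame_det Q, Z])"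

lemma vec3_expand: "x = x$1 *s axis 1 1 + x$2 *s axis 2 1 + x$3 *s (axis 3 1 :: vec3)"
  by (simp add: vec_eq_iff forall_3 axis_def)

lemma trace_form_expand: "trace_form Q x = trace_form Q (axis 1 1) * x$1 + trace_form Q (axis 2 1) * x$2 + trace_form Q (axis 3 1) * x$3"
  using arg_cong[OF vec3_expand[of x], of "trace_form Q"] by (simp add: trace_form_add trace_form_scale mult.commute)

lemma frame_vec_nth_3: "frame_vec Q X Y Z $ 3 = Z"
  by (simp add: frame_vec_def Let_def)

lemma
  assumes "frame_det Q \<noteq> 0"
  shows ell_form_frame_vec: "ell_form Q (frame_vec Q X Y Z) = X" and trace_form_frame_vec: "trace_form Q (frame_vec Q X Y Z) = Y"
proof -
  define l where "l j = ell_form Q (axis j 1)" for j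
  define t where "t j = trace_form Q (axis j 1)" for j
  have d: "frame_det Q = l 1 * t 2 - l 2 * t 1"
    by (simp add: frame_det_def l_def t_def)
  have frame_vec: "frame_det Q * frame_vec Q X Y Z $ 1 = t 2 * X - l 2 * Y + (l 2 * t 3 - l 3 * t 2) * Z"
    "frame_det Q * frame_vec Q X Y Z $ 2 = l 1 * Y - t 1 * X + (l 3 * t 1 - l 1 * t 3) * Z"
    using assms by (simp_all add: frame_vec_def Let_def l_def t_def)
  have "frame_det Q * (l 1 * frame_vec Q X Y Z $ 1 + l 2 * frame_vec Q X Y Z $ 2 + l 3 * Z) = frame_det Q * X"
    "frame_det Q * (t 1 * frame_vec Q X Y Z $ 1 + t 2 * frame_vec Q X Y Z $ 2 + t 3 * Z) = frame_det Q * Y"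
    using frame_vec d by algebra+
  then show "ell_form Q (frame_vec Q X Y Z) = X" "trace_form Q (frame_vec Q X Y Z) = Y"
    using assms ell_form_expand[of Q "frame_vec Q X Y Z"] trace_form_expand[of Q "frame_vec Q X Y Z"]
    by (simp_all add: frame_vec_nth_3 flip: l_def t_def)
qed

lemma frame_eqI:
  assumes d: "frame_det Q \<noteq> 0" and "ell_form Q x = ell_form Q y" "trace_form Q x = trace_form Q y" "x$3 = y$3"
  shows "x = y"
proof -
  define u where "u = x - y"
  have "ell_form Q u = 0" "trace_form Q u = 0" "u$3 = 0"
    using assms(2-4) ell_form_add[of Q u y] trace_form_add[of Q u y] by (simp_all add: u_def)
  then have "ell_form Q (axis 1 1) * u$1 + ell_form Q (axis 2 1) * u$2 = 0" "trace_form Q (axis 1 1) * u$1 + trace_form Q (axis 2 1) * u$2 = 0"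
    using ell_form_expand[of Q u] trace_form_expand[of Q u] by simp_all
  then have "frame_det Q * u$1 = 0" "frame_det Q * u$2 = 0" unfolding frame_det_def by algebra+
  with d \<open>u$3 = 0\<close> have "u = 0" by (simp add: vec_eq_iff forall_3)
  then show ?thesis by (simp add: u_def)
qed

lemma frame_vec_frame:
  assumes "frame_det Q \<noteq> 0"
  shows "frame_vec Q (ell_form Q x) (trace_form Q x) (x$3) = x"
  by (rule frame_eqI[OF assms]) (simp_all add: ell_form_frame_vec[OF assms] trace_form_frame_vec[OF assms] frame_vec_nth_3)

lemma frame_vec_linear:
  "frame_det Q \<noteq> 0 \<Longrightarrow> frame_vec Q X Y Z = X *s frame_vec Q 1 0 0 + Y *s frame_vec Q 0 1 0 + Z *s frame_vec Q 0 0 1"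
  by (rule frame_eqI[of Q]) (simp_all add: ell_form_frame_vec trace_form_frame_vec frame_vec_nth_3 ell_form_add trace_form_add ell_form_scale trace_form_scale)

text \<open>The content is the shared coefficient \<open>a\<close>, with opposite signs: for the
  vector \<open>g\<close> with coordinates (0, 0, 1), \<open>DW(g)\<close> has trace
  \<open>\<tau>(g) = 0\<close> on \<open>K\<close>.\<close>

lemma normal_form:
  assumes Q: "preserves_ell Q" and d: "frame_det Q \<noteq> 0"
  obtains A B C A' B' C' a b c a' c' where
    "\<And>X Y Z. ell_form Q (transverse Q (frame_vec Q X Y Z)) = A * X\<^sup>2 + B * (X * Y) + C * Y\<^sup>2 + Z * (a * X + b * Y + c * Z)"
    "\<And>X Y Z. trace_form Q (transverse Q (frame_vec Q X Y Z)) = A' * X\<^sup>2 + B' * (X * Y) + C' * Y\<^sup>2 + Z * (a' * X - a * Y + c' * Z)"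
proof -
  define e f g where "e = frame_vec Q 1 0 0" and "f = frame_vec Q 0 1 0" and "g = frame_vec Q 0 0 1"
  have exp: "transverse Q (frame_vec Q X Y Z) = X\<^sup>2 *s transverse Q e + Y\<^sup>2 *s transverse Q f + Z\<^sup>2 *s transverse Q g
      + (X * Y) *s polar Q e f + (X * Z) *s polar Q g e + (Y * Z) *s polar Q g f" for X Y Z
    unfolding frame_vec_linear[OF d, of X Y Z] e_def[symmetric] f_def[symmetric] g_def[symmetric]
    by (simp add: transverse_add transverse_scale polar_add_right polar_scale_right polar_add_left polar_scale_left
        polar_commute[of Q _ g] vec_eq_iff algebra_simps)
  have trace: "trace_form Q (polar Q g f) = - ell_form Q (polar Q g e)"
  proof -
    define l where "l j = ell_form Q (axis j 1)" for j
    define t where "t j = trace_form Q (axis j 1)" for j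
    define T where "T i j = deriv_W Q i j g" for i j
    have d: "frame_det Q = l 1 * t 2 - l 2 * t 1"
      by (simp add: frame_det_def l_def t_def)
    have ef: "frame_det Q * e$1 = t 2" "frame_det Q * e$2 = - t 1" "e$3 = 0"
      "frame_det Q * f$1 = - l 2" "frame_det Q * f$2 = l 1" "f$3 = 0"
      using assms by (simp_all add: e_def f_def frame_vec_def Let_def l_def t_def)
    have b: "polar Q g y $ 1 = T 1 1 * y$1 + T 1 2 * y$2" "polar Q g y $ 2 = T 2 1 * y$1 + T 2 2 * y$2"
      if "y$3 = 0" for y
      using that by (simp_all add: polar_deriv_W T_def)
    have b3: "polar Q x y $ 3 = 0" for x y
      by (simp add: polar_def transverse_3[OF Q])
    \<comment> \<open>\<open>e\<close> and \<open>f\<close> are the basis of \<open>K\<close> dual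
      to \<open>L\<close> and \<open>\<tau>\<close>, so these two numbers are the diagonal entries
      of \<open>DW(g)\<close> on \<open>K\<close>.\<close>
    have "ell_form Q (polar Q g e) = l 1 * (T 1 1 * e$1 + T 1 2 * e$2) + l 2 * (T 2 1 * e$1 + T 2 2 * e$2)"
      "trace_form Q (polar Q g f) = t 1 * (T 1 1 * f$1 + T 1 2 * f$2) + t 2 * (T 2 1 * f$1 + T 2 2 * f$2)"
      by (simp_all add: ell_form_expand[of Q "polar Q g e"] trace_form_expand[of Q "polar Q g f"] b ef b3 l_def t_def)
    then have "frame_det Q * (ell_form Q (polar Q g e) + trace_form Q (polar Q g f)) = frame_det Q * (T 1 1 + T 2 2)"
      using ef d by algebra
    then have "ell_form Q (polar Q g e) + trace_form Q (polar Q g f) = T 1 1 + T 2 2"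
      using assms by simp
    also have "\<dots> = trace_form Q g" by (simp add: trace_form_def T_def)
    also have "\<dots> = 0" using assms by (simp add: g_def trace_form_frame_vec)
    finally show ?thesis by (simp add: eq_neg_iff_add_eq_0 add.commute)
  qed
  show thesis
  proof (rule that)
    fix X Y Z
    show "ell_form Q (transverse Q (frame_vec Q X Y Z)) = ell_form Q (transverse Q e) * X\<^sup>2 + ell_form Q (polar Q e f) * (X * Y) + ell_form Q (transverse Q f) * Y\<^sup>2
        + Z * (ell_form Q (polar Q g e) * X + ell_form Q (polar Q g f) * Y + ell_form Q (transverse Q g) * Z)"
      unfolding exp by (simp add: ell_form_add ell_form_scale algebra_simps power2_eq_square)
    show "trace_form Q (transverse Q (frame_vec Q X Y Z)) = trace_form Q (transverse Q e) * X\<^sup>2 + trace_form Q (polar Q e f) * (X * Y) + trace_form Q (transverse Q f) * Y\<^sup>2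
        + Z * (trace_form Q (polar Q g e) * X - ell_form Q (polar Q g e) * Y + trace_form Q (transverse Q g) * Z)"
      unfolding exp by (simp add: trace_form_add trace_form_scale trace algebra_simps power2_eq_square)
  qed
qed

subsection \<open>The fixed points on the line\<close>

text \<open>Over the complex numbers a squarefree polynomial is a constant times distinct linear
  factors, one for each root.\<close>

lemma three_simple_roots:
  fixes p :: "complex poly"
  assumes "degree p = 3" "\<And>x. poly p x = 0 \<Longrightarrow> poly (pderiv p) x \<noteq> 0"
  shows "card {x. poly p x = 0} = 3"
proof -
  have "rsquarefree p" unfolding rsquarefree_roots using assms(2) by blast
  have "p \<noteq> 0" using assms(1) by auto
  have "degree p = degree (smult (lead_coeff p) (\<Prod>z | poly p z = 0. [:- z, 1:]))"
    using complex_poly_decompose_rsquarefree[OF \<open>rsquarefree p\<close>] by simp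
  also have "\<dots> = card {x. poly p x = 0}"
    using \<open>p \<noteq> 0\<close> by (simp add: degree_prod_eq_sum_degree)
  finally show ?thesis using assms(1) by simp
qed

text \<open>The slopes of the fixed points are the roots of a cubic.
  \<open>Q$1$2$2 \<noteq> 0\<close> says that (0:1:0) is not fixed, and nondegeneracy makes the
  roots simple, because the derivative at a root is \<open>- c * u\<close>.\<close>

lemma fixed_points_on_ell:
  assumes E: "E4 Q P" and c: "Q$1$2$2 \<noteq> 0"
  obtains m :: "3 \<Rightarrow> complex" where "inj m" "\<And>i. vector [1, m i, 0] \<in> FixN Q \<inter> {x. x$3 = 0}"
proof -
  \<comment> \<open>The second component of the map at \<open>(1, x, 0)\<close> minus
    \<open>x\<close> times the first.\<close>
  define p :: "complex poly" where "p = [: Q$2$1$1, Q$2$1$2 + Q$2$2$1 - Q$1$1$1,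
      Q$2$2$2 - Q$1$1$2 - Q$1$2$1, - Q$1$2$2 :]"
  have Q: "preserves_ell Q" "holo_quad Q" and det: "\<And>x. is_fixed Q x \<Longrightarrow> det_IDf Q x \<noteq> 0"
    using E unfolding E4_def by blast+
  have "degree p = 3" using c by (simp add: p_def)
  have fixed: "vector [1, x, 0] \<in> FixN Q \<inter> {x. x$3 = 0}
      \<and> poly (pderiv p) x \<noteq> 0" if "poly p x = 0" for x
  proof -
    define v :: vec3 where "v = vector [1, x, 0]"
    have v: "v$1 = 1" "v$2 = x" "v$3 = 0" by (simp_all add: v_def)
    then have v0: "v \<noteq> 0" by auto
    have "qeval Q v $ 2 = x * qeval Q v $ 1"
      using that by (simp add: p_def qeval_def sum_3 v algebra_simps power2_eq_square)
    then have fx: "qeval Q v = qeval Q v $ 1 *s v"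
      using qeval_3[OF Q(1), of v] by (simp add: vec_eq_iff forall_3 v)
    have "is_fixed Q v" unfolding is_fixed_def using fx v0 by blast
    have c0: "qeval Q v $ 1 \<noteq> 0"
      using fx Q(2) v0 unfolding holo_quad_def by (metis vector_smult_lzero)
    have idx: "chart_idx v = 1" by (simp add: chart_idx_def v)
    have "fst (uv_ell Q v) \<noteq> 0"
      using multipliers_on_ell(3)[OF Q(1) fx c0 v0 v(3)] det[OF \<open>is_fixed Q v\<close>] by auto
    moreover have "poly (pderiv p) x = - qeval Q v $ 1 * fst (uv_ell Q v)"
      using c0
      by (simp add: uv_ell_def idx chart_coords_def jac_fixed[OF fx c0 v0] v field_simps)
        (simp add: p_def pderiv_pCons qeval_def deriv_q_def sum_3 v algebra_simps)
    moreover have "normalize3 v = v" by (simp add: normalize3_def idx v)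
    ultimately show ?thesis using \<open>is_fixed Q v\<close> c0 v(3) by (simp add: FixN_def flip: v_def)
  qed
  have "card {x. poly p x = 0} = 3"
    by (rule three_simple_roots) (use fixed \<open>degree p = 3\<close> in blast)+
  then obtain m :: "3 \<Rightarrow> complex" where m: "bij_betw m UNIV {x. poly p x = 0}"
    using finite_same_card_bij[of "UNIV :: 3 set" "{x. poly p x = 0}"] card.infinite[of "{x. poly p x = 0}"]
    by fastforce
  then have "inj m" "poly p (m i) = 0" for i by (auto simp: bij_betw_def)
  with fixed that show thesis by blast
qed

text \<open>Dividing a representative by its multiplier gives a vector fixed by \<open>F\<close>
  itself. Its frame coordinates depend only on \<open>(u, v)\<close>, which allows comparing two
  maps.\<close>

lemma ell_fixed_frame:
  assumes Q: "preserves_ell Q" "holo_quad Q" and d: "frame_det Q \<noteq> 0"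
    and x: "x \<in> FixN Q \<inter> {x. x$3 = 0}" and uv: "uv_ell Q x = (u, v)"
  obtains c where "c \<noteq> 0" "x = c *s frame_vec Q (1 - v) (3 * v - u) 0"
    "transverse Q (frame_vec Q (1 - v) (3 * v - u) 0) = v *s frame_vec Q (1 - v) (3 * v - u) 0"
proof -
  have fixed: "is_fixed Q x" and x3: "x$3 = 0" using x by (auto simp: FixN_def)
  then have x0: "x \<noteq> 0" by (simp add: is_fixed_def)
  obtain c where c: "c \<noteq> 0" "qeval Q x = c *s x" using fixed_multiplier[OF Q(2) fixed] .
  define q where "q = (1/c) *s x"
  have q: "ell_form Q q = 1 - v" "trace_form Q q = 3 * v - u" "q$3 = 0"
    using multipliers_on_ell(1,2)[OF Q(1) c(2,1) x0 x3] by (simp_all add: q_def uv ell_form_scale trace_form_scale x3)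
  then have q_frame_vec: "q = frame_vec Q (1 - v) (3 * v - u) 0" using frame_vec_frame[OF d, of q] by simp
  have "qeval Q q = q" using c by (simp add: q_def qeval_scale power2_eq_square)
  then have "transverse Q q = v *s q" by (simp add: transverse_def q vec_eq_iff algebra_simps)
  moreover have "x = c *s q" using c by (simp add: q_def)
  ultimately show thesis using that c(1) unfolding q_frame_vec by blast
qed

lemma ell_multipliers_set:
  assumes "E4 Q P" "E4 Q' P'" "ell_multipliers Q = ell_multipliers Q'"
  shows "uv_ell Q ` (FixN Q \<inter> {x. x$3 = 0}) = uv_ell Q' ` (FixN Q' \<inter> {x. x$3 = 0})"
proof -
  \<comment> \<open>Finiteness matters here: \<open>mset_set\<close> of an infinite set is
    empty.\<close>
  have "finite (FixN Q)" "finite (FixN Q')" using assms(1,2) by (simp_all add: E4_def)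
  then show ?thesis
    using arg_cong[OF assms(3), of set_mset] by (simp add: ell_multipliers_def)
qed

text \<open>In frame coordinates both restrictions take the same values at three pairwise
  independent vectors given by the multipliers, so the difference of each component is a binary
  quadratic form with three zeros.\<close>

lemma restriction_determined:
  assumes E: "E4 Q P" "E4 Q' P'" and m: "ell_multipliers Q = ell_multipliers Q'"
    and c: "Q$1$2$2 \<noteq> 0" and d: "frame_det Q \<noteq> 0" "frame_det Q' \<noteq> 0"
  shows "ell_form Q (transverse Q (frame_vec Q X Y 0)) = ell_form Q' (transverse Q' (frame_vec Q' X Y 0))"
    and "trace_form Q (transverse Q (frame_vec Q X Y 0)) = trace_form Q' (transverse Q' (frame_vec Q' X Y 0))"
proof -
  have Q: "preserves_ell Q" "holo_quad Q" and Q': "preserves_ell Q'" "holo_quad Q'"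
    using E unfolding E4_def by blast+
  obtain x :: "3 \<Rightarrow> complex" where x: "inj x" "\<And>i. vector [1, x i, 0] \<in> FixN Q \<inter> {x. x$3 = 0}"
    using fixed_points_on_ell[OF E(1) c] by blast
  define f g where "f i = 1 - snd (uv_ell Q (vector [1, x i, 0]))"
    and "g i = 3 * snd (uv_ell Q (vector [1, x i, 0])) - fst (uv_ell Q (vector [1, x i, 0]))" for i
  have rep: "\<exists>c. c \<noteq> 0 \<and> vector [1, x i, 0] = c *s frame_vec Q (f i) (g i) 0" for i
    using ell_fixed_frame[OF Q d(1) x(2) prod.collapse[symmetric], of i] unfolding f_def g_def by blast
  have val: "transverse Q (frame_vec Q (f i) (g i) 0) = (1 - f i) *s frame_vec Q (f i) (g i) 0" for i
    using ell_fixed_frame[OF Q d(1) x(2) prod.collapse[symmetric], of i] unfolding f_def g_def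
    by (metis (no_types) add_diff_cancel_left' diff_add_cancel)
  \<comment> \<open>A fixed point of \<open>Q'\<close> with the same pair of eigenvalues has the
    same frame coordinates.\<close>
  have val': "transverse Q' (frame_vec Q' (f i) (g i) 0) = (1 - f i) *s frame_vec Q' (f i) (g i) 0" for i
  proof -
    obtain y where y: "y \<in> FixN Q' \<inter> {x. x$3 = 0}" "uv_ell Q' y = uv_ell Q (vector [1, x i, 0])"
      using ell_multipliers_set[OF E m] x(2)[of i] by (metis (no_types, lifting) imageE imageI)
    show ?thesis
      using ell_fixed_frame[OF Q' d(2) y(1), of "fst (uv_ell Q (vector [1, x i, 0]))" "snd (uv_ell Q (vector [1, x i, 0]))"] y(2)
      unfolding f_def g_def by (metis (no_types) add_diff_cancel_left' diff_add_cancel prod.collapse)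
  qed
  \<comment> \<open>Distinct points of the line stay distinct in the coordinates \<open>L\<close>
    and \<open>\<tau>\<close> of \<open>K\<close>.\<close>
  have indep: "f i * g j \<noteq> f j * g i" if "i \<noteq> j" for i j
  proof
    assume eq: "f i * g j = f j * g i"
    obtain a b where ab: "a \<noteq> 0" "b \<noteq> 0" "vector [1, x i, 0] = a *s frame_vec Q (f i) (g i) 0"
      "vector [1, x j, 0] = b *s frame_vec Q (f j) (g j) 0" using rep by meson
    have fg: "ell_form Q (vector [1, x i, 0]) = a * f i" "trace_form Q (vector [1, x i, 0]) = a * g i"
      "ell_form Q (vector [1, x j, 0]) = b * f j" "trace_form Q (vector [1, x j, 0]) = b * g j"
      by (simp_all add: ab ell_form_scale trace_form_scale ell_form_frame_vec[OF d(1)] trace_form_frame_vec[OF d(1)])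
    have "a * f i * (b * g j) - b * f j * (a * g i) = frame_det Q * (x j - x i)"
      unfolding fg[symmetric] ell_form_expand[of Q "vector _"] trace_form_expand[of Q "vector _"] frame_det_def
      by (simp add: algebra_simps)
    moreover have "a * f i * (b * g j) - b * f j * (a * g i) = 0" using eq by algebra
    ultimately have "x j = x i" using d(1) by simp
    with x(1) that show False by (simp add: inj_eq)
  qed
  obtain A B C A' B' C' a b c a' c' where nf:
    "\<And>X Y Z. ell_form Q (transverse Q (frame_vec Q X Y Z)) = A * X\<^sup>2 + B * (X * Y) + C * Y\<^sup>2 + Z * (a * X + b * Y + c * Z)"
    "\<And>X Y Z. trace_form Q (transverse Q (frame_vec Q X Y Z)) = A' * X\<^sup>2 + B' * (X * Y) + C' * Y\<^sup>2 + Z * (a' * X - a * Y + c' * Z)"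
    using normal_form[OF Q(1) d(1)] by metis
  obtain A2 B2 C2 A2' B2' C2' a2 b2 c2 a2' c2' where nf2:
    "\<And>X Y Z. ell_form Q' (transverse Q' (frame_vec Q' X Y Z)) = A2 * X\<^sup>2 + B2 * (X * Y) + C2 * Y\<^sup>2 + Z * (a2 * X + b2 * Y + c2 * Z)"
    "\<And>X Y Z. trace_form Q' (transverse Q' (frame_vec Q' X Y Z)) = A2' * X\<^sup>2 + B2' * (X * Y) + C2' * Y\<^sup>2 + Z * (a2' * X - a2 * Y + c2' * Z)"
    using normal_form[OF Q'(1) d(2)] by metis
  have "A - A2 = 0 \<and> B - B2 = 0 \<and> C - C2 = 0"
  proof (rule binary_quadratic_zero[OF _ indep])
    fix i :: 3
    have "ell_form Q (transverse Q (frame_vec Q (f i) (g i) 0)) = ell_form Q' (transverse Q' (frame_vec Q' (f i) (g i) 0))"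
      by (simp only: val val' ell_form_scale ell_form_frame_vec[OF d(1)] ell_form_frame_vec[OF d(2)])
    then show "(A - A2) * (f i)\<^sup>2 + (B - B2) * (f i * g i) + (C - C2) * (g i)\<^sup>2 = 0"
      by (simp add: nf nf2 algebra_simps)
  qed
  then show "ell_form Q (transverse Q (frame_vec Q X Y 0)) = ell_form Q' (transverse Q' (frame_vec Q' X Y 0))" by (simp add: nf nf2)
  have "A' - A2' = 0 \<and> B' - B2' = 0 \<and> C' - C2' = 0"
  proof (rule binary_quadratic_zero[OF _ indep])
    fix i :: 3
    have "trace_form Q (transverse Q (frame_vec Q (f i) (g i) 0)) = trace_form Q' (transverse Q' (frame_vec Q' (f i) (g i) 0))"
      by (simp only: val val' trace_form_scale trace_form_frame_vec[OF d(1)] trace_form_frame_vec[OF d(2)])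
    then show "(A' - A2') * (f i)\<^sup>2 + (B' - B2') * (f i * g i) + (C' - C2') * (g i)\<^sup>2 = 0"
      by (simp add: nf nf2 algebra_simps)
  qed
  then show "trace_form Q (transverse Q (frame_vec Q X Y 0)) = trace_form Q' (transverse Q' (frame_vec Q' X Y 0))" by (simp add: nf nf2)
qed

subsection \<open>Reconstruction from the multipliers\<close>

text \<open>This and the next two definitions evaluate at the representative with
  \<open>L = 1\<close>. On \<open>E4\<close>, \<open>trace_at\<close> is \<open>- t\<^sub>i\<close>
  and \<open>det_at\<close> is \<open>d\<^sub>i\<close>.\<close>

definition trace_at :: "qmap \<Rightarrow> complex^3^4 \<Rightarrow> 4 \<Rightarrow> complex" where
  "trace_at Q P i = trace_form Q (P$i) / ell_form Q (P$i)"

definition height_at :: "qmap \<Rightarrow> complex^3^4 \<Rightarrow> 4 \<Rightarrow> complex" where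
  "height_at Q P i = P$i$3 / ell_form Q (P$i)"

definition det_at :: "qmap \<Rightarrow> complex^3^4 \<Rightarrow> 4 \<Rightarrow> complex" where
  "det_at Q P i = det_form Q (P$i) / (ell_form Q (P$i))\<^sup>2"

text \<open>The trace obstruction for the second isotropic line, computed from the data of
  \<open>Q\<close> alone.\<close>

definition conj_obstruction :: "qmap \<Rightarrow> complex^3^4 \<Rightarrow> complex" where
  "conj_obstruction Q P = obstruction (trace_at Q P) (\<lambda>i. ell_form Q (transverse Q (frame_vec Q 1 (trace_at Q P i) 0)))
     (\<lambda>i. trace_form Q (transverse Q (frame_vec Q 1 (trace_at Q P i) 0))) (conj_root (trace_at Q P) (det_at Q P) (height_at Q P))"

text \<open>Nonzero exactly when no three marked points are collinear.\<close>

definition minors :: "complex^3^4 \<Rightarrow> complex" where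
  "minors P = det3 (P$1) (P$2) (P$3) * det3 (P$4) (P$2) (P$3) * det3 (P$1) (P$4) (P$3) * det3 (P$1) (P$2) (P$4)"

text \<open>Off the line the third component forces the multiplier to be \<open>L\<close>, so
  \<open>W\<close> vanishes at the point.\<close>

lemma marked_point:
  assumes "E4 Q P"
  shows "P$i$3 \<noteq> 0" "ell_form Q (P$i) \<noteq> 0" "transverse Q (P$i) = 0"
    "tr_IDf Q (P$i) = - trace_at Q P i" "det_IDf Q (P$i) = det_at Q P i" "det_at Q P i \<noteq> 0" "height_at Q P i \<noteq> 0"
proof -
  have Q: "preserves_ell Q" "holo_quad Q" and fixed: "is_fixed Q (P$i)" and det: "det_IDf Q (P$i) \<noteq> 0"
    using assms unfolding E4_def by blast+
  show P3: "P$i$3 \<noteq> 0" using assms unfolding E4_def by blast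
  obtain c where c: "c \<noteq> 0" "qeval Q (P$i) = c *s P$i" using fixed_multiplier[OF Q(2) fixed] .
  then have cL: "c = ell_form Q (P$i)" using qeval_3[OF Q(1), of "P$i"] P3 by simp
  then show L0: "ell_form Q (P$i) \<noteq> 0" and "transverse Q (P$i) = 0" using c by (simp_all add: transverse_def)
  show "tr_IDf Q (P$i) = - trace_at Q P i" "det_IDf Q (P$i) = det_at Q P i"
    using tr_det_off_ell[OF Q(1) c(2)[unfolded cL] L0 P3] by (simp_all add: trace_at_def det_at_def)
  with det show "det_at Q P i \<noteq> 0" by simp
  show "height_at Q P i \<noteq> 0" using P3 L0 by (simp add: height_at_def)
qed

lemma det3_scale: "det3 (a *s x) (b *s y) (c *s z) = a * b * c * det3 x y z"
  by (simp add: det3_def algebra_simps)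

lemma marked_point_frame:
  assumes "E4 Q P" "frame_det Q \<noteq> 0"
  shows "P$i = ell_form Q (P$i) *s frame_vec Q 1 (trace_at Q P i) (height_at Q P i)"
    and "transverse Q (frame_vec Q 1 (trace_at Q P i) (height_at Q P i)) = 0"
proof -
  define q where "q = (1 / ell_form Q (P$i)) *s P$i"
  have "frame_vec Q 1 (trace_at Q P i) (height_at Q P i) = q"
    using frame_vec_frame[OF assms(2), of q] marked_point(2)[OF assms(1)]
    by (simp add: q_def ell_form_scale trace_form_scale trace_at_def height_at_def)
  then show "P$i = ell_form Q (P$i) *s frame_vec Q 1 (trace_at Q P i) (height_at Q P i)" "transverse Q (frame_vec Q 1 (trace_at Q P i) (height_at Q P i)) = 0"
    using marked_point(2,3)[OF assms(1)] by (simp_all add: q_def transverse_scale)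
qed

lemma ell_form_zero: "ell_form Q 0 = 0" and trace_form_zero: "trace_form Q 0 = 0"
  using ell_form_scale[of Q 0 0] trace_form_scale[of Q 0 0] by simp_all

text \<open>Apply \<open>L\<close>, \<open>\<tau>\<close> and \<open>x$3\<close> to the Euler-Jacobi
  relation at the representatives with \<open>L = 1\<close>.\<close>

lemma marked_points_isotropic:
  assumes E: "E4 Q P" and m: "minors P \<noteq> 0"
  defines "s \<equiv> trace_at Q P" and "d \<equiv> det_at Q P" and "z \<equiv> height_at Q P"
  shows "(\<Sum>i\<in>UNIV. z i / d i) = 0" "(\<Sum>i\<in>UNIV. s i * z i / d i) = 0" "(\<Sum>i\<in>UNIV. z i * z i / d i) = 0"
proof -
  define q :: "vec3^4" where "q = (\<chi> i. (1 / ell_form Q (P$i)) *s P$i)"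
  note mp = marked_point[OF E]
  have q: "q$i$3 = z i" "det_form Q (q$i) = d i" "ell_form Q (q$i) = 1" "trace_form Q (q$i) = s i" "transverse Q (q$i) = 0" for i
    using mp(2,3) by (simp_all add: q_def z_def height_at_def d_def det_at_def s_def trace_at_def ell_form_scale trace_form_scale
        det_form_scale transverse_scale power_divide)
  have "(\<Sum>i\<in>UNIV. (q$i$3 / det_form Q (q$i)) *s q$i) = 0"
  proof (rule euler_jacobi)
    show "transverse Q (q$i) = 0" "q$i$3 \<noteq> 0" "det_form Q (q$i) \<noteq> 0" for i
      using q mp by (simp_all add: z_def d_def)
  qed (use m mp(2) in \<open>simp_all add: minors_def q_def det3_scale\<close>)
  then have sum0: "(\<Sum>i\<in>UNIV. (z i / d i) *s q$i) = 0" by (simp add: q)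
  show "(\<Sum>i\<in>UNIV. z i / d i) = 0"
    using arg_cong[OF sum0, of "ell_form Q"] by (simp add: sum_4 ell_form_add ell_form_scale q ell_form_zero)
  show "(\<Sum>i\<in>UNIV. s i * z i / d i) = 0"
    using arg_cong[OF sum0, of "trace_form Q"] by (simp add: sum_4 trace_form_add trace_form_scale q trace_form_zero mult.commute)
  show "(\<Sum>i\<in>UNIV. z i * z i / d i) = 0"
    using arg_cong[OF sum0, of "\<lambda>x. x$3"] by (simp add: sum_4 q)
qed

lemma det3_frame:
  "frame_det Q * det3 x y w = ell_form Q x * (trace_form Q y * w$3 - y$3 * trace_form Q w) - trace_form Q x * (ell_form Q y * w$3 - y$3 * ell_form Q w)
     + x$3 * (ell_form Q y * trace_form Q w - trace_form Q y * ell_form Q w)"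
  unfolding frame_det_def det3_def ell_form_expand[of Q x] ell_form_expand[of Q y] ell_form_expand[of Q w]
    trace_form_expand[of Q x] trace_form_expand[of Q y] trace_form_expand[of Q w] by (simp add: algebra_simps)

text \<open>In the frame the first three points are \<open>(1, s i, z i)\<close>, with determinant
  minus this sum. It supplies the nondegeneracy assumption of
  \<open>isotropic_alternative\<close>.\<close>

lemma marked_points_gap:
  assumes E: "E4 Q P" and m: "minors P \<noteq> 0" and d: "frame_det Q \<noteq> 0"
  shows "(\<Sum>j\<in>UNIV. height_at Q P j * gap (trace_at Q P) j) \<noteq> 0"
proof
  assume "(\<Sum>j\<in>UNIV. height_at Q P j * gap (trace_at Q P) j) = 0"
  define q where "q i = frame_vec Q 1 (trace_at Q P i) (height_at Q P i)" for i
  have "frame_det Q * det3 (q 1) (q 2) (q 3) = - (\<Sum>j\<in>UNIV. height_at Q P j * gap (trace_at Q P) j)"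
    unfolding det3_frame q_def by (simp add: ell_form_frame_vec d trace_form_frame_vec frame_vec_nth_3 sum_4 gap_simps algebra_simps)
  then have "det3 (q 1) (q 2) (q 3) = 0" using d \<open>_ = 0\<close> by simp
  moreover have "P$i = ell_form Q (P$i) *s q i" for i
    unfolding q_def by (rule marked_point_frame(1)[OF E d])
  then have "det3 (P$1) (P$2) (P$3) = ell_form Q (P$1) * ell_form Q (P$2) * ell_form Q (P$3) * det3 (q 1) (q 2) (q 3)"
    by (subst det3_scale[symmetric]) simp
  ultimately have "det3 (P$1) (P$2) (P$3) = 0" by simp
  with m show False by (simp add: minors_def)
qed

lemma normal_form':
  assumes "preserves_ell Q" "frame_det Q \<noteq> 0"
  obtains a b c a' c' where
    "\<And>X Y Z. ell_form Q (transverse Q (frame_vec Q X Y Z)) = ell_form Q (transverse Q (frame_vec Q X Y 0)) + Z * (a * X + b * Y + c * Z)"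
    "\<And>X Y Z. trace_form Q (transverse Q (frame_vec Q X Y Z)) = trace_form Q (transverse Q (frame_vec Q X Y 0)) + Z * (a' * X - a * Y + c' * Z)"
proof -
  obtain A B C A' B' C' a b c a' c' where
    "\<And>X Y Z. ell_form Q (transverse Q (frame_vec Q X Y Z)) = A * X\<^sup>2 + B * (X * Y) + C * Y\<^sup>2 + Z * (a * X + b * Y + c * Z)"
    "\<And>X Y Z. trace_form Q (transverse Q (frame_vec Q X Y Z)) = A' * X\<^sup>2 + B' * (X * Y) + C' * Y\<^sup>2 + Z * (a' * X - a * Y + c' * Z)"
    using normal_form[OF assms] by metis
  then show thesis by (intro that[of a b c a' c']) simp_all
qed

section \<open>The conjugating linear map\<close>

definition frame_map :: "qmap \<Rightarrow> qmap \<Rightarrow> complex \<Rightarrow> vec3 \<Rightarrow> vec3" where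
  "frame_map Q Q' k x = frame_vec Q' (ell_form Q x) (trace_form Q x) (k * x$3)"

lemma
  assumes "frame_det Q' \<noteq> 0"
  shows ell_form_frame_map: "ell_form Q' (frame_map Q Q' k x) = ell_form Q x"
    and trace_form_frame_map: "trace_form Q' (frame_map Q Q' k x) = trace_form Q x"
    and frame_map_3: "frame_map Q Q' k x $ 3 = k * x$3"
  using assms by (simp_all add: frame_map_def ell_form_frame_vec trace_form_frame_vec frame_vec_nth_3)

lemma frame_map_matrix:
  assumes d: "frame_det Q \<noteq> 0" "frame_det Q' \<noteq> 0" and k: "k \<noteq> 0"
  obtains M where "aut_ell M" "\<And>x. M *v x = frame_map Q Q' k x"
proof -
  define M :: "complex^3^3" where "M = (\<chi> i j. frame_map Q Q' k (axis j 1) $ i)"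
  have lin: "frame_map Q Q' k x = ell_form Q x *s frame_vec Q' 1 0 0 + trace_form Q x *s frame_vec Q' 0 1 0 + (k * x$3) *s frame_vec Q' 0 0 1" for x
    unfolding frame_map_def by (rule frame_vec_linear[OF d(2)])
  have M: "M *v x = frame_map Q Q' k x" for x
    unfolding lin ell_form_expand[of Q x] trace_form_expand[of Q x]
    by (simp add: M_def lin matrix_vector_mult_def sum_3 vec_eq_iff axis_def algebra_simps)
  have "x = 0" if "M *v x = 0" for x
  proof -
    have "frame_vec Q' (ell_form Q x) (trace_form Q x) (k * x$3) = 0" using that by (simp add: M frame_map_def)
    then have "ell_form Q x = 0" "trace_form Q x = 0" "k * x$3 = 0"
      by (metis ell_form_frame_vec[OF d(2)] ell_form_zero, metis trace_form_frame_vec[OF d(2)] trace_form_zero, metis frame_vec_nth_3 zero_index)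
    then show ?thesis using frame_eqI[OF d(1), of x 0] k by (simp add: ell_form_zero trace_form_zero)
  qed
  then have "invertible M" using matrix_left_invertible_ker invertible_left_inverse by blast
  then have "aut_ell M" by (simp add: aut_ell_def M_def frame_map_def frame_vec_nth_3 axis_def)
  with M that show thesis by blast
qed

text \<open>The restrictions to \<open>K\<close> agree, so only the terms divisible by the height
  are left; the zeros at three marked points fix their coefficients. Since \<open>frame_map\<close>
  preserves \<open>L\<close>, conjugating \<open>W\<close> also conjugates
  \<open>F = W + L x\<close>.\<close>

lemma frame_map_conjugates:
  assumes E: "E4 Q P" "E4 Q' P'" and d: "frame_det Q \<noteq> 0" "frame_det Q' \<noteq> 0"
    and D: "(\<Sum>j\<in>UNIV. height_at Q P j * gap (trace_at Q P) j) \<noteq> 0"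
    and res: "\<And>X Y. ell_form Q (transverse Q (frame_vec Q X Y 0)) = ell_form Q' (transverse Q' (frame_vec Q' X Y 0))"
      "\<And>X Y. trace_form Q (transverse Q (frame_vec Q X Y 0)) = trace_form Q' (transverse Q' (frame_vec Q' X Y 0))"
    and s: "\<And>i. trace_at Q' P' i = trace_at Q P i" and z: "\<And>i. height_at Q' P' i = k * height_at Q P i"
  shows "qeval Q' (frame_map Q Q' k x) = frame_map Q Q' k (qeval Q x)"
proof -
  have Q: "preserves_ell Q" and Q': "preserves_ell Q'" using E unfolding E4_def by blast+
  obtain a b c a' c' where nf:
    "\<And>X Y Z. ell_form Q (transverse Q (frame_vec Q X Y Z)) = ell_form Q (transverse Q (frame_vec Q X Y 0)) + Z * (a * X + b * Y + c * Z)"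
    "\<And>X Y Z. trace_form Q (transverse Q (frame_vec Q X Y Z)) = trace_form Q (transverse Q (frame_vec Q X Y 0)) + Z * (a' * X - a * Y + c' * Z)"
    using normal_form'[OF Q d(1)] by metis
  obtain a2 b2 c2 a2' c2' where nf2:
    "\<And>X Y Z. ell_form Q' (transverse Q' (frame_vec Q' X Y Z)) = ell_form Q' (transverse Q' (frame_vec Q' X Y 0)) + Z * (a2 * X + b2 * Y + c2 * Z)"
    "\<And>X Y Z. trace_form Q' (transverse Q' (frame_vec Q' X Y Z)) = trace_form Q' (transverse Q' (frame_vec Q' X Y 0)) + Z * (a2' * X - a2 * Y + c2' * Z)"
    using normal_form'[OF Q' d(2)] by metis
  define pt :: "3 \<Rightarrow> 4" where "pt i = (if i = 1 then 1 else if i = 2 then 2 else 3)" for i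
  define f where "f i = trace_at Q P (pt i)" for i
  define g where "g i = height_at Q P (pt i)" for i
  have det: "1 * (f 2 * g 3 - f 3 * g 2) - f 1 * (1 * g 3 - 1 * g 2) + g 1 * (1 * f 3 - 1 * f 2) \<noteq> 0"
    using D by (simp add: f_def g_def pt_def sum_4 gap_simps algebra_simps)
  have q: "transverse Q (frame_vec Q 1 (f i) (g i)) = 0" "transverse Q' (frame_vec Q' 1 (f i) (k * g i)) = 0" "g i \<noteq> 0" for i
    using marked_point_frame(2)[OF E(1) d(1), of "pt i"] marked_point_frame(2)[OF E(2) d(2), of "pt i"]
      marked_point(7)[OF E(1)] by (simp_all add: f_def g_def s z)
  \<comment> \<open>Subtract the two normal forms at corresponding zeros. The height
    \<open>k * g i\<close> brings one factor \<open>k\<close> for each power of the height.\<close>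
  have "g i * (((k * a2 - a) * 1 + (k * b2 - b) * f i + (k * k * c2 - c) * g i)) = 0"
    and "g i * (((k * a2' - a') * 1 + (- (k * a2) + a) * f i + (k * k * c2' - c') * g i)) = 0" for i
    using nf[of 1 "f i" "g i"] nf2[of 1 "f i" "k * g i"] unfolding q res ell_form_zero trace_form_zero by algebra+
  then have "k * a2 - a = 0 \<and> k * b2 - b = 0 \<and> k * k * c2 - c = 0"
    "k * a2' - a' = 0 \<and> - (k * a2) + a = 0 \<and> k * k * c2' - c' = 0"
    using q(3) by (intro linear_3_zero[OF _ det]; simp)+
  then have co: "a = k * a2" "b = k * b2" "c = k * k * c2" "a' = k * a2'" "c' = k * k * c2'" by simp_all
  define X Y Z where "X = ell_form Q x" and "Y = trace_form Q x" and "Z = x$3"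
  have x: "x = frame_vec Q X Y Z" by (simp add: X_def Y_def Z_def frame_vec_frame d)
  have g: "frame_map Q Q' k x = frame_vec Q' X Y (k * Z)" by (simp add: frame_map_def X_def Y_def Z_def)
  have L: "ell_form Q (transverse Q x) = ell_form Q' (transverse Q' (frame_vec Q' X Y 0)) + Z * (a * X + b * Y + c * Z)"
    unfolding res(1)[symmetric] nf(1)[symmetric] by (simp only: x[symmetric])
  have T: "trace_form Q (transverse Q x) = trace_form Q' (transverse Q' (frame_vec Q' X Y 0)) + Z * (a' * X - a * Y + c' * Z)"
    unfolding res(2)[symmetric] nf(2)[symmetric] by (simp only: x[symmetric])
  note fm = ell_form_frame_map[OF d(2)] trace_form_frame_map[OF d(2)] frame_map_3[OF d(2)]
  have "transverse Q' (frame_map Q Q' k x) = frame_map Q Q' k (transverse Q x)"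
  proof (rule frame_eqI[OF d(2)])
    show "ell_form Q' (transverse Q' (frame_map Q Q' k x)) = ell_form Q' (frame_map Q Q' k (transverse Q x))"
      unfolding fm g L nf2(1)[of X Y "k * Z"] co by (simp add: algebra_simps)
    show "trace_form Q' (transverse Q' (frame_map Q Q' k x)) = trace_form Q' (frame_map Q Q' k (transverse Q x))"
      unfolding fm g T nf2(2)[of X Y "k * Z"] co by (simp add: algebra_simps)
    show "transverse Q' (frame_map Q Q' k x) $ 3 = frame_map Q Q' k (transverse Q x) $ 3"
      unfolding fm by (simp add: transverse_3 Q Q')
  qed
  then have "qeval Q' (frame_map Q Q' k x) = frame_map Q Q' k (transverse Q x) + ell_form Q x *s frame_map Q Q' k x"
    using transverse_def[of Q' "frame_map Q Q' k x"] unfolding fm by (metis diff_add_cancel)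
  also have "\<dots> = frame_map Q Q' k (transverse Q x + ell_form Q x *s x)"
    by (rule frame_eqI[OF d(2)]) (simp_all add: fm ell_form_add trace_form_add ell_form_scale trace_form_scale algebra_simps)
  finally show ?thesis by (simp add: transverse_def)
qed

text \<open>The multipliers leave two candidates for the heights up to scale. The obstruction
  excludes the second, and the first makes \<open>frame_map\<close> a conjugacy.\<close>

lemma conjugate_if_same_multipliers:
  assumes E: "E4 Q P" "E4 Q' P'" and d: "frame_det Q \<noteq> 0" "frame_det Q' \<noteq> 0" and c: "Q$1$2$2 \<noteq> 0"
    and m: "minors P \<noteq> 0" "minors P' \<noteq> 0" and conj_obstruction: "conj_obstruction Q P \<noteq> 0"
    and mult: "\<And>i. tr_IDf Q (P$i) = tr_IDf Q' (P'$i)" "\<And>i. det_IDf Q (P$i) = det_IDf Q' (P'$i)"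
    and ell: "ell_multipliers Q = ell_multipliers Q'"
  shows "\<exists>M. aut_ell M
            \<and> (\<exists>c. c \<noteq> 0 \<and> (\<forall>x. qeval Q' (M *v x) = c *s (M *v qeval Q x)))
            \<and> (\<forall>i. \<exists>c. c \<noteq> 0 \<and> M *v (P$i) = c *s (P'$i))"
proof -
  have s: "trace_at Q' P' i = trace_at Q P i" and dd: "det_at Q' P' i = det_at Q P i" for i
    using mult[of i] marked_point(4,5)[OF E(1), of i] marked_point(4,5)[OF E(2), of i] by simp_all
  have s': "trace_at Q' P' = trace_at Q P" and dd': "det_at Q' P' = det_at Q P" using s dd by auto
  note res = restriction_determined[OF E ell c d]
  note gap = marked_points_gap[OF E(1) m(1) d(1)]
  have "\<exists>k. k \<noteq> 0 \<and> ((\<forall>i. height_at Q' P' i = k * height_at Q P i)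
      \<or> (\<forall>i. height_at Q' P' i = k * conj_root (trace_at Q P) (det_at Q P) (height_at Q P) i))"
    by (rule isotropic_alternative[OF marked_point(6)[OF E(1)] marked_point(7)[OF E(1)] marked_point(7)[OF E(2)]
        gap marked_points_isotropic[OF E(1) m(1)] marked_points_isotropic[OF E(2) m(2), unfolded s' dd']])
  then obtain k where k: "k \<noteq> 0" and alt: "(\<forall>i. height_at Q' P' i = k * height_at Q P i)
      \<or> (\<forall>i. height_at Q' P' i = k * conj_root (trace_at Q P) (det_at Q P) (height_at Q P) i)" by blast
  from alt have z: "height_at Q' P' i = k * height_at Q P i" for i
  proof
    assume "\<forall>i. height_at Q' P' i = k * conj_root (trace_at Q P) (det_at Q P) (height_at Q P) i"
    then have z': "height_at Q' P' = (\<lambda>i. k * conj_root (trace_at Q P) (det_at Q P) (height_at Q P) i)" by auto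
    have "preserves_ell Q'" using E(2) unfolding E4_def by blast
    then obtain a b c a' c' where nf:
      "\<And>X Y Z. ell_form Q' (transverse Q' (frame_vec Q' X Y Z)) = ell_form Q' (transverse Q' (frame_vec Q' X Y 0)) + Z * (a * X + b * Y + c * Z)"
      "\<And>X Y Z. trace_form Q' (transverse Q' (frame_vec Q' X Y Z)) = trace_form Q' (transverse Q' (frame_vec Q' X Y 0)) + Z * (a' * X - a * Y + c' * Z)"
      using normal_form'[OF _ d(2)] by metis
    \<comment> \<open>The zeros of the second map, with its restriction to \<open>K\<close> replaced
      by that of \<open>Q\<close>, give the equations of \<open>obstruction_zero\<close>.\<close>
    have "obstruction (trace_at Q P) (\<lambda>i. ell_form Q (transverse Q (frame_vec Q 1 (trace_at Q P i) 0)))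
        (\<lambda>i. trace_form Q (transverse Q (frame_vec Q 1 (trace_at Q P i) 0))) (height_at Q' P') = 0"
    proof (rule obstruction_zero)
      fix i
      have W: "transverse Q' (frame_vec Q' 1 (trace_at Q P i) (height_at Q' P' i)) = 0"
        using marked_point_frame(2)[OF E(2) d(2), of i] by (simp add: s)
      show "ell_form Q (transverse Q (frame_vec Q 1 (trace_at Q P i) 0)) = - height_at Q' P' i * (a + b * trace_at Q P i + c * height_at Q' P' i)"
        using nf(1)[of 1 "trace_at Q P i" "height_at Q' P' i"] unfolding W ell_form_zero res by algebra
      show "trace_form Q (transverse Q (frame_vec Q 1 (trace_at Q P i) 0)) = - height_at Q' P' i * (a' - a * trace_at Q P i + c' * height_at Q' P' i)"
        using nf(2)[of 1 "trace_at Q P i" "height_at Q' P' i"] unfolding W trace_form_zero res by algebra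
    qed
    then have "k ^ 3 * conj_obstruction Q P = 0" unfolding z' obstruction_scale conj_obstruction_def by simp
    with k conj_obstruction show ?thesis by simp
  qed blast
  obtain M where M: "aut_ell M" "\<And>x. M *v x = frame_map Q Q' k x" using frame_map_matrix[OF d k] by blast
  have "\<exists>c. c \<noteq> 0 \<and> M *v (P$i) = c *s (P'$i)" for i
  proof (intro exI conjI)
    show "ell_form Q (P$i) / ell_form Q' (P'$i) \<noteq> 0" using marked_point(2)[OF E(1)] marked_point(2)[OF E(2)] by simp
    have "M *v P$i = ell_form Q (P$i) *s frame_vec Q' 1 (trace_at Q' P' i) (height_at Q' P' i)"
      using marked_point(2)[OF E(1), of i]
      by (intro frame_eqI[OF d(2)])
        (simp_all add: M ell_form_frame_map trace_form_frame_map frame_map_3 ell_form_frame_vec trace_form_frame_vec frame_vec_nth_3 d ell_form_scale trace_form_scale s z trace_at_def[of Q] height_at_def[of Q])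
    then show "M *v P$i = (ell_form Q (P$i) / ell_form Q' (P'$i)) *s P'$i"
      using marked_point_frame(1)[OF E(2) d(2), of i] marked_point(2)[OF E(2), of i]
      by (metis (no_types, lifting) nonzero_divide_eq_eq vector_smult_assoc)
  qed
  \<comment> \<open>The homogeneous lifts are conjugate exactly, with scalar 1.\<close>
  moreover have "\<exists>c. c \<noteq> 0 \<and> (\<forall>x. qeval Q' (M *v x) = c *s (M *v qeval Q x))"
    using frame_map_conjugates[OF E d gap res s z] by (intro exI[of _ 1]) (simp add: M)
  ultimately show ?thesis using M(1) by blast
qed

subsection \<open>The genericity conditions are rational\<close>

lemma rat_on_ell_form: "(\<And>i. rat_on S (\<lambda>z. v z $ i)) \<Longrightarrow> rat_on S (\<lambda>z. ell_form (fst z) (v z))"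
  unfolding ell_form_def by (intro rat_on_add rat_on_mult rat_on_coeff)

lemma rat_on_qeval: "(\<And>i. rat_on S (\<lambda>z. v z $ i)) \<Longrightarrow> rat_on S (\<lambda>z. qeval (fst z) (v z) $ i)"
  unfolding qeval_def by (simp, intro rat_on_sum rat_on_mult rat_on_coeff finite)

lemma rat_on_transverse: "(\<And>i. rat_on S (\<lambda>z. v z $ i)) \<Longrightarrow> rat_on S (\<lambda>z. transverse (fst z) (v z) $ i)"
  unfolding transverse_def vector_minus_component vector_smult_component
  by (intro rat_on_diff rat_on_mult rat_on_ell_form rat_on_qeval)

lemma rat_on_deriv_W:
  assumes "\<And>i. rat_on S (\<lambda>z. v z $ i)" shows "rat_on S (\<lambda>z. deriv_W (fst z) i j (v z))"
proof -
  have "rat_on S (\<lambda>z. if i = j then ell_form (fst z) (v z) else 0)"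
    by (cases "i = j") (simp_all add: rat_on_ell_form rat_on_const assms)
  then show ?thesis
    unfolding deriv_W_def deriv_q_def
    by (intro rat_on_diff rat_on_mult rat_on_sum rat_on_add rat_on_coeff rat_on_const rat_on_ell_form finite assms)
qed

lemma rat_on_trace_form: "(\<And>i. rat_on S (\<lambda>z. v z $ i)) \<Longrightarrow> rat_on S (\<lambda>z. trace_form (fst z) (v z))"
  unfolding trace_form_def by (intro rat_on_add rat_on_deriv_W)

lemma rat_on_det_form: "(\<And>i. rat_on S (\<lambda>z. v z $ i)) \<Longrightarrow> rat_on S (\<lambda>z. det_form (fst z) (v z))"
  unfolding det_form_def by (intro rat_on_diff rat_on_mult rat_on_deriv_W)

lemma rat_on_frame_det: "rat_on S (\<lambda>z. frame_det (fst z))"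
  unfolding frame_det_def by (intro rat_on_diff rat_on_mult rat_on_ell_form rat_on_trace_form rat_on_const)

lemma rat_on_frame_vec:
  assumes "\<And>z. z \<in> S \<Longrightarrow> frame_det (fst z) \<noteq> 0" "rat_on S X" "rat_on S Y"
  shows "rat_on S (\<lambda>z. frame_vec (fst z) (X z) (Y z) 0 $ i)"
proof -
  have "rat_on S (\<lambda>z. frame_vec (fst z) (X z) (Y z) 0 $ 1)" "rat_on S (\<lambda>z. frame_vec (fst z) (X z) (Y z) 0 $ 2)"
    "rat_on S (\<lambda>z. frame_vec (fst z) (X z) (Y z) 0 $ 3)"
    unfolding frame_vec_def Let_def vector_3
    by (intro rat_on_add rat_on_divide rat_on_diff rat_on_mult rat_on_ell_form rat_on_trace_form rat_on_frame_det rat_on_const assms;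
        simp)+
  then show ?thesis using exhaust_3[of i] by auto
qed

lemma rat_on_minors: "rat_on S (\<lambda>z. minors (snd z))"
  unfolding minors_def det3_def by (intro rat_on_add rat_on_diff rat_on_mult rat_on_point)

lemma
  assumes "\<And>z. z \<in> S \<Longrightarrow> E4 (fst z) (snd z)"
  shows rat_on_trace_at: "rat_on S (\<lambda>z. trace_at (fst z) (snd z) i)"
    and rat_on_height_at: "rat_on S (\<lambda>z. height_at (fst z) (snd z) i)"
    and rat_on_det_at: "rat_on S (\<lambda>z. det_at (fst z) (snd z) i)"
proof -
  have nz: "ell_form (fst z) (snd z $ i) \<noteq> 0" if "z \<in> S" for z i
    using marked_point(2)[OF assms[OF that]] .
  show "rat_on S (\<lambda>z. trace_at (fst z) (snd z) i)"
    unfolding trace_at_def by (intro rat_on_divide rat_on_trace_form rat_on_ell_form rat_on_point nz)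
  show "rat_on S (\<lambda>z. height_at (fst z) (snd z) i)"
    unfolding height_at_def by (intro rat_on_divide rat_on_ell_form rat_on_point nz)
  show "rat_on S (\<lambda>z. det_at (fst z) (snd z) i)"
    unfolding det_at_def power2_eq_square
    by (intro rat_on_divide rat_on_det_form rat_on_mult rat_on_ell_form rat_on_point) (simp add: nz)
qed

lemma rat_on_conj_root:
  assumes "\<And>z. z \<in> S \<Longrightarrow> E4 (fst z) (snd z)"
  shows "rat_on S (\<lambda>z. conj_root (trace_at (fst z) (snd z)) (det_at (fst z) (snd z)) (height_at (fst z) (snd z)) i)"
proof -
  have trace_at: "rat_on S (\<lambda>z. trace_at (fst z) (snd z) j)" for j by (rule rat_on_trace_at[OF assms])
  have "rat_on S (\<lambda>z. gap (trace_at (fst z) (snd z)) j)" for j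
    by (insert exhaust_4[of j], elim disjE; simp only: gap_simps; intro rat_on_diff rat_on_const trace_at)
  then show ?thesis
    unfolding conj_root_def power2_eq_square
    by (intro rat_on_diff rat_on_mult rat_on_sum rat_on_const finite rat_on_height_at[OF assms] rat_on_det_at[OF assms])
qed

lemma rat_on_conj_obstruction:
  assumes "\<And>z. z \<in> S \<Longrightarrow> E4 (fst z) (snd z) \<and> frame_det (fst z) \<noteq> 0"
  shows "rat_on S (\<lambda>z. conj_obstruction (fst z) (snd z))"
proof -
  have E: "\<And>z. z \<in> S \<Longrightarrow> E4 (fst z) (snd z)" and d: "\<And>z. z \<in> S \<Longrightarrow> frame_det (fst z) \<noteq> 0"
    using assms by blast+
  have W: "rat_on S (\<lambda>z. transverse (fst z) (frame_vec (fst z) 1 (trace_at (fst z) (snd z) j) 0) $ i)" for i j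
    by (rule rat_on_transverse, rule rat_on_frame_vec[OF d rat_on_const rat_on_trace_at[OF E]])
  show ?thesis
    unfolding conj_obstruction_def obstruction_def
    by (intro rat_on_add rat_on_diff rat_on_mult rat_on_conj_root[OF E] rat_on_trace_at[OF E]
        rat_on_ell_form[OF W] rat_on_trace_form[OF W])
qed

text \<open>The formula for \<open>conj_obstruction\<close> divides by \<open>frame_det\<close>. So
  one polynomial detects \<open>frame_det\<close>, a second one the other conditions where it is
  nonzero, and their product detects all of them.\<close>

lemma generic_polynomial:
  obtains p where "poly_fn p"
    "\<And>Q P. E4 Q P \<Longrightarrow> p (Q, P) \<noteq> 0 \<longleftrightarrow> frame_det Q \<noteq> 0 \<and> Q$1$2$2 \<noteq> 0 \<and> minors P \<noteq> 0 \<and> conj_obstruction Q P \<noteq> 0"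
proof -
  define S where "S = {z. E4 (fst z) (snd z) \<and> frame_det (fst z) \<noteq> 0}"
  obtain p where p: "poly_fn p" "\<And>z. z \<in> UNIV \<Longrightarrow> p z \<noteq> 0 \<longleftrightarrow> frame_det (fst z) \<noteq> 0"
    using rat_on_nonvanishing[OF rat_on_frame_det] by blast
  have "rat_on S (\<lambda>z. fst z $ 1 $ 2 $ 2 * minors (snd z) * conj_obstruction (fst z) (snd z))"
    by (intro rat_on_mult rat_on_coeff rat_on_minors rat_on_conj_obstruction) (simp add: S_def)
  then obtain q where q: "poly_fn q" "\<And>z. z \<in> S \<Longrightarrow> q z \<noteq> 0 \<longleftrightarrow> fst z $ 1 $ 2 $ 2 * minors (snd z) * conj_obstruction (fst z) (snd z) \<noteq> 0"
    using rat_on_nonvanishing by blast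
  have "p (Q, P) * q (Q, P) \<noteq> 0 \<longleftrightarrow> frame_det Q \<noteq> 0 \<and> Q$1$2$2 \<noteq> 0 \<and> minors P \<noteq> 0 \<and> conj_obstruction Q P \<noteq> 0" if "E4 Q P" for Q P
    using p(2)[of "(Q, P)"] q(2)[of "(Q, P)"] that by (auto simp: S_def)
  then show thesis using that[of "\<lambda>z. p z * q z"] pf_mult[OF p(1) q(1)] by blast
qed

subsection \<open>A generic map\<close>

text \<open>Chosen so that all seven fixed points are rational; those on the line are
  \<open>(-1:1:0)\<close>, \<open>(1:2:0)\<close> and \<open>(2:3:0)\<close>.\<close>

definition example_map :: qmap where
  "example_map = vector [vector [vector [0, 6, 1], vector [0, -2, 2], vector [0, 0, 0]],
                 vector [vector [6, -1, -6], vector [0, 1, 1], vector [0, 0, 0]],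
                 vector [vector [0, 0, 0], vector [0, 0, 1], vector [0, 0, 1]]]"

definition example_points :: "complex^3^4" where
  "example_points = (\<chi> i. if i = 1 then vector [0, 0, 1] else if i = 2 then vector [1, 0, 1]
    else if i = 3 then vector [0, 1, 1] else vector [2, 6, 1])"

lemma example_points_simps: "example_points$1 = vector [0, 0, 1]" "example_points$2 = vector [1, 0, 1]" "example_points$3 = vector [0, 1, 1]" "example_points$4 = vector [2, 6, 1]"
  by (simp_all add: example_points_def)

lemma example_qeval:
  "qeval example_map x $ 1 = 6 * x$1 * x$2 + x$1 * x$3 - 2 * x$2 * x$2 + 2 * x$2 * x$3"
  "qeval example_map x $ 2 = 6 * x$1 * x$1 - x$1 * x$2 - 6 * x$1 * x$3 + x$2 * x$2 + x$2 * x$3"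
  "qeval example_map x $ 3 = x$3 * (x$2 + x$3)"
  by (simp_all add: qeval_def example_map_def sum_3 algebra_simps)

lemma example_forms: "ell_form example_map x = x$2 + x$3"
  "deriv_W example_map 1 1 x = 5 * x$2" "deriv_W example_map 1 2 x = 5 * x$1 - 4 * x$2 + 2 * x$3"
  "deriv_W example_map 2 1 x = 12 * x$1 - x$2 - 6 * x$3" "deriv_W example_map 2 2 x = - x$1"
  by (simp_all add: ell_form_def deriv_W_def deriv_q_def example_map_def sum_3 axis_def algebra_simps)

lemma example_trace_form: "trace_form example_map x = 5 * x$2 - x$1"
  by (simp add: trace_form_def example_forms)

lemma example_preserves: "preserves_ell example_map"
  by (simp add: preserves_ell_def example_qeval)

text \<open>Off the line, each component of \<open>W\<close> is a product of two linear forms, so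
  the zeros are intersections of lines. On the line, the cubic splits.\<close>

lemma example_classify:
  assumes "qeval example_map x = c *s x" "x \<noteq> 0"
  shows "(\<exists>i. x = x$3 *s example_points$i) \<and> x$3 \<noteq> 0 \<and> c = x$2 + x$3
    \<or> (\<exists>t. t \<noteq> 0 \<and> (x = t *s vector [-1, 1, 0] \<and> c = 8 * t
        \<or> x = t *s vector [1, 2, 0] \<and> c = 4 * t \<or> x = t *s vector [2, 3, 0] \<and> c = 9 * t))"
proof -
  define a b z where "a = x$1" and "b = x$2" and "z = x$3"
  have x: "x = vector [a, b, z]" by (simp add: vec_eq_iff forall_3 a_def b_def z_def)
  have e1: "6 * a * b + a * z - 2 * b * b + 2 * b * z = c * a"
    and e2: "6 * a * a - a * b - 6 * a * z + b * b + b * z = c * b" and e3: "z * (b + z) = c * z"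
    using arg_cong[OF assms(1), of "\<lambda>x. x$1"] arg_cong[OF assms(1), of "\<lambda>x. x$2"]
      arg_cong[OF assms(1), of "\<lambda>x. x$3"] by (simp_all add: example_qeval a_def b_def z_def)
  show ?thesis
  proof (cases "z = 0")
    case False
    then have c: "c = b + z" using e3 by simp
    have "b * (5 * a - 2 * b + 2 * z) = 0" "a * (6 * a - b - 6 * z) = 0"
      using e1 e2 unfolding c by algebra+
    then consider "a = 0" "b = 0" | "b = 0" "6 * a - b - 6 * z = 0" | "a = 0" "5 * a - 2 * b + 2 * z = 0"
      | "6 * a - b - 6 * z = 0" "5 * a - 2 * b + 2 * z = 0" by auto
    then have "\<exists>i. x = z *s example_points$i"
    proof cases
      case 1 then show ?thesis
        by (intro exI[of _ 1]) (simp add: example_points_simps x vec_eq_iff forall_3)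
    next
      case 2 then show ?thesis
        by (intro exI[of _ 2]) (simp add: example_points_simps x vec_eq_iff forall_3)
    next
      case 3 then show ?thesis
        by (intro exI[of _ 3]) (simp add: example_points_simps x vec_eq_iff forall_3)
    next
      case 4
      then have "b = 6 * z" "a = 2 * z" by algebra+
      then show ?thesis
        by (intro exI[of _ 4]) (simp add: example_points_simps x vec_eq_iff forall_3)
    qed
    with False c show ?thesis by (simp add: z_def b_def)
  next
    case z: True
    \<comment> \<open>Eliminating \<open>c\<close> from \<open>e1\<close> and \<open>e2\<close>
      gives this cubic.\<close>
    have "(a + b) * ((2 * a - b) * (3 * a - 2 * b)) = 0" using e1 e2 unfolding z by algebra
    then consider "a = - b" | "b = 2 * a" | "3 * a = 2 * b" by (auto simp: eq_neg_iff_add_eq_0)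
    then show ?thesis
    proof cases
      case 1
      then have "b \<noteq> 0" using assms(2) z by (auto simp: x vec_eq_iff forall_3)
      moreover have "c * b = 8 * b * b" using e2 unfolding z 1 by algebra
      ultimately show ?thesis using 1 z
        by (intro disjI2 exI[of _ b]) (simp add: x vec_eq_iff forall_3)
    next
      case 2
      then have "a \<noteq> 0" using assms(2) z by (auto simp: x vec_eq_iff forall_3)
      moreover have "c * a = 4 * a * a" using e2 unfolding z 2 by algebra
      ultimately show ?thesis using 2 z
        by (intro disjI2 exI[of _ a]) (simp add: x vec_eq_iff forall_3)
    next
      case 3
      define t where "t = b / 3"
      have b: "b = 3 * t" by (simp add: t_def)
      have "3 * a = 3 * (2 * t)" unfolding 3 b by simp
      then have a: "a = 2 * t" by simp
      with b have "t \<noteq> 0" using assms(2) z by (auto simp: x vec_eq_iff forall_3)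
      moreover have "c * t = 9 * t * t" using e2 unfolding z a b by algebra
      ultimately show ?thesis using z
        by (intro disjI2 exI[of _ t]) (simp add: x vec_eq_iff forall_3 a b)
    qed
  qed
qed

text \<open>A nonzero vector sent to zero would have multiplier 0. The multipliers on the line are
  nonzero, and off it \<open>x$2 + x$3 = 0\<close> would need a marked point with second coordinate
  -1.\<close>

lemma example_holo: "holo_quad example_map"
  unfolding holo_quad_def
proof (intro allI impI, rule ccontr)
  fix x assume x: "qeval example_map x = 0" "x \<noteq> 0"
  have "(\<exists>i. x = x$3 *s example_points$i) \<and> x$3 \<noteq> 0 \<and> 0 = x$2 + x$3"
    using example_classify[of x 0] x by auto
  then obtain i where *: "x$2 = x$3 * example_points$i$2" "x$3 \<noteq> 0" "0 = x$2 + x$3" by (metis vector_smult_component)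
  then have "x$3 * (example_points$i$2 + 1) = 0" by (simp add: algebra_simps)
  with *(2) show False using exhaust_4[of i] by (auto simp: example_points_simps)
qed

lemma example_point: "qeval example_map (example_points$i) = ell_form example_map (example_points$i) *s example_points$i" "example_points$i$3 = 1" "ell_form example_map (example_points$i) \<noteq> 0"
    "det_form example_map (example_points$i) \<noteq> 0"
  using exhaust_4[of i] by (auto simp: example_points_simps vec_eq_iff forall_3 example_qeval example_forms det_form_def)

lemma normalize3_scale:
  assumes "t \<noteq> 0" shows "normalize3 (t *s x) = normalize3 x"
proof -
  have "chart_idx (t *s x) = chart_idx x" using assms by (simp add: chart_idx_def)
  then show ?thesis using assms by (simp add: normalize3_def)
qed

lemma example_det:
  assumes "is_fixed example_map x" shows "det_IDf example_map x \<noteq> 0"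
proof -
  have x0: "x \<noteq> 0" using assms by (simp add: is_fixed_def)
  obtain c where c: "c \<noteq> 0" "qeval example_map x = c *s x" using fixed_multiplier[OF example_holo assms] .
  \<comment> \<open>The product \<open>u * v\<close> with \<open>v = 1 - L / c\<close> and
    \<open>u = 3 * v - \<tau> / c\<close>.\<close>
  have det: "det_IDf example_map x = (3 * (1 - ell_form example_map x / c) - trace_form example_map x / c) * (1 - ell_form example_map x / c)" if "x$3 = 0"
    using multipliers_on_ell[OF example_preserves c(2,1) x0 that] by simp
  from example_classify[OF c(2) x0] show ?thesis
  proof (elim disjE exE conjE)
    fix i assume i: "x = x$3 *s example_points$i" and x3: "x$3 \<noteq> 0" and "c = x$2 + x$3"
    then have cL: "c = ell_form example_map x" by (simp add: example_forms)
    have "det_form example_map x = (x$3)\<^sup>2 * det_form example_map (example_points$i)" by (metis i det_form_scale)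
    then show ?thesis
      using tr_det_off_ell(2)[OF example_preserves c(2)[unfolded cL] c(1)[unfolded cL] x3] c(1) x3 example_point(4)
      by (simp flip: cL)
  qed (use det in \<open>auto simp: example_forms example_trace_form\<close>)
qed

lemma example_E4: "E4 example_map example_points"
  unfolding E4_def
proof (intro conjI allI impI example_holo example_preserves example_det)
  have "FixN example_map \<subseteq> range (\<lambda>i. normalize3 (example_points$i)) \<union>
      normalize3 ` {vector [-1, 1, 0], vector [1, 2, 0], vector [2, 3, 0]}" (is "_ \<subseteq> ?R")
  proof
    fix x assume "x \<in> FixN example_map"
    then have x: "x \<noteq> 0" "normalize3 x = x" and "\<exists>c. qeval example_map x = c *s x"
      by (simp_all add: FixN_def is_fixed_def)
    then obtain c where "qeval example_map x = c *s x" by blast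
    from example_classify[OF this x(1)] show "x \<in> ?R"
    proof (elim disjE exE conjE)
      fix i assume "x = x$3 *s example_points$i" "x$3 \<noteq> 0"
      then have "x = normalize3 (example_points$i)" using x(2) by (metis normalize3_scale)
      then show ?thesis by blast
    qed (use x(2) in \<open>auto simp: normalize3_scale\<close>)
  qed
  then show "finite (FixN example_map)" by (rule finite_subset) simp
  fix i j :: 4
  show "is_fixed example_map (example_points$i)"
    unfolding is_fixed_def using example_point(1,2)[of i] by (metis zero_index zero_neq_one)
  show "example_points$i$3 \<noteq> 0" by (simp add: example_point(2))
  show "normalize3 (example_points$i) \<noteq> normalize3 (example_points$j)" if "i \<noteq> j"
    using that exhaust_4[of i] exhaust_4[of j]
    by (auto simp: example_points_simps normalize3_def chart_idx_def vec_eq_iff forall_3)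
next
  fix x assume x: "is_fixed example_map x \<and> x$3 \<noteq> 0"
  then obtain c where "qeval example_map x = c *s x" "x \<noteq> 0" by (auto simp: is_fixed_def)
  from example_classify[OF this] x obtain i where "x = x$3 *s example_points$i" by auto
  with x show "\<exists>i. normalize3 x = normalize3 (example_points$i)" by (metis normalize3_scale)
qed

lemma example_frame_det: "frame_det example_map = 1"
  by (simp add: frame_det_def example_forms example_trace_form axis_def)

lemma example_minors: "minors example_points \<noteq> 0"
  by (simp add: minors_def det3_def example_points_simps)

text \<open>On \<open>K\<close> the frame coordinates mean \<open>x$2 = X\<close> and
  \<open>x$1 = 5 * X - Y\<close>. These closed forms reduce the obstruction to rational
  arithmetic.\<close>

lemma example_transverse: "ell_form example_map (transverse example_map (frame_vec example_map X Y 0)) = (5 * X - Y) * (6 * (5 * X - Y) - X)"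
  "trace_form example_map (transverse example_map (frame_vec example_map X Y 0)) = 5 * ((5 * X - Y) * (6 * (5 * X - Y) - X)) - X * (5 * (5 * X - Y) - 2 * X)"
  by (simp_all add: frame_vec_def Let_def example_frame_det example_forms example_trace_form transverse_def example_qeval axis_def algebra_simps)

lemma example_conj_obstruction: "conj_obstruction example_map example_points \<noteq> 0"
proof -
  have s: "trace_at example_map example_points 1 = 0" "trace_at example_map example_points 2 = -1" "trace_at example_map example_points 3 = 5/2" "trace_at example_map example_points 4 = 4"
    by (simp_all add: trace_at_def example_points_simps example_forms example_trace_form)
  have z: "height_at example_map example_points 1 = 1" "height_at example_map example_points 2 = 1" "height_at example_map example_points 3 = 1/2" "height_at example_map example_points 4 = 1/7"
    by (simp_all add: height_at_def example_points_simps example_forms)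
  have d: "det_at example_map example_points 1 = 12" "det_at example_map example_points 2 = -42" "det_at example_map example_points 3 = -7/2" "det_at example_map example_points 4 = 12/7"
    by (simp_all add: det_at_def det_form_def example_points_simps example_forms power2_eq_square)
  show ?thesis
    by (simp add: conj_obstruction_def obstruction_def conj_root_def gap_simps sum_4 s z d example_transverse power2_eq_square)
qed

theorem theorem2:
  shows "\<exists>Pol. poly_fn Pol \<and> (\<exists>Q P. E4 Q P \<and> Pol (Q, P) \<noteq> 0) \<and>
    (\<forall>Q P Q' P'. E4 Q P \<and> Pol (Q, P) \<noteq> 0 \<and> E4 Q' P' \<and> Pol (Q', P') \<noteq> 0
       \<and> (\<forall>i. tr_IDf Q (P$i) = tr_IDf Q' (P'$i) \<and> det_IDf Q (P$i) = det_IDf Q' (P'$i))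
       \<and> ell_multipliers Q = ell_multipliers Q'
     \<longrightarrow> (\<exists>M. aut_ell M
            \<and> (\<exists>c. c \<noteq> 0 \<and> (\<forall>x. qeval Q' (M *v x) = c *s (M *v qeval Q x)))
            \<and> (\<forall>i. \<exists>c. c \<noteq> 0 \<and> M *v (P$i) = c *s (P'$i))))"
proof -
  obtain p where p: "poly_fn p"
    "\<And>Q P. E4 Q P \<Longrightarrow> p (Q, P) \<noteq> 0 \<longleftrightarrow> frame_det Q \<noteq> 0 \<and> Q$1$2$2 \<noteq> 0 \<and> minors P \<noteq> 0 \<and> conj_obstruction Q P \<noteq> 0"
    using generic_polynomial by blast
  have "example_map$1$2$2 \<noteq> 0" by (simp add: example_map_def)
  then have "p (example_map, example_points) \<noteq> 0"
    using p(2)[OF example_E4] example_frame_det example_minors example_conj_obstruction by simp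
  show ?thesis
  proof (intro exI[of _ p] conjI allI impI p(1))
    show "\<exists>Q P. E4 Q P \<and> p (Q, P) \<noteq> 0" using example_E4 \<open>p (example_map, example_points) \<noteq> 0\<close> by blast
    fix Q P Q' P'
    assume *: "E4 Q P \<and> p (Q, P) \<noteq> 0 \<and> E4 Q' P' \<and> p (Q', P') \<noteq> 0
       \<and> (\<forall>i. tr_IDf Q (P$i) = tr_IDf Q' (P'$i) \<and> det_IDf Q (P$i) = det_IDf Q' (P'$i))
       \<and> ell_multipliers Q = ell_multipliers Q'"
    then have "frame_det Q \<noteq> 0 \<and> Q$1$2$2 \<noteq> 0 \<and> minors P \<noteq> 0 \<and> conj_obstruction Q P \<noteq> 0" "frame_det Q' \<noteq> 0 \<and> minors P' \<noteq> 0"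
      using p(2) by blast+
    with * show "\<exists>M. aut_ell M
            \<and> (\<exists>c. c \<noteq> 0 \<and> (\<forall>x. qeval Q' (M *v x) = c *s (M *v qeval Q x)))
            \<and> (\<forall>i. \<exists>c. c \<noteq> 0 \<and> M *v (P$i) = c *s (P'$i))"
      by (intro conjugate_if_same_multipliers) blast+
  qed
qed

end
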